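(* Let $K$ be a connected p.c.f. self-similar set with a regular harmonic structure $(H_0,\mathbf r)$ and a self-similar measure $\mu$, with Laplacian $\Delta_\mu$ and spectral dimension $d_S$. Suppose there exists $\lambda_0>0$ such that $\#\mathrm{Extr}(u_\lambda)\le 1$ for any $\lambda$-eigenfunction $u_\lambda$ of $-\Delta_\mu$ with $0\le\lambda<\lambda_0$. Then, for $\Gamma$ being either the Dirichlet extremum counting function $\Gamma_D$ or the Neumann extremum counting function $\Gamma_N$, $$\limsup_{x\to\infty}\frac{\Gamma(x)}{x^{d_S/2}}<\infty .$$
   Context: Self-similar set: $(X,d)$ complete metric space, $S=\{1,\dots,s\}$, $s\ge2$, $\{F_i\}_{i\in S}$ contractions on $X$, $K$ the unique nonempty compact set with $K=\bigcup_{i\in S}F_iK$. $W_m=S^m$, $W_0=\{\varnothing\}$, $W_*=\bigcup_{m\ge0}W_m$, $F_w=F_{w_1}\circ\cdots\circ F_{w_m}$, $F_\varnothing=\mathrm{id}$. $\Sigma=S^{\mathbb N}$ with shift $\sigma$; $\Pi:\Sigma\to K$ is given by $\{\Pi(\omega)\}=\bigcap_{m\ge1}F_{\omega_1\cdots\omega_m}K$. Critical set $\mathscr C=\Pi^{-1}(\bigcup_{i\ne j}(F_iK\cap F_jK))$, post-critical set $\mathscr P=\bigcup_{m\ge1}\sigma^m(\mathscr C)$; $K$ is p.c.f. if $\#\mathscr P<\infty$. $V_0=\Pi(\mathscr P)$ is the boundary, $V_m=\bigcup_{w\in W_m}F_wV_0$, $V_*=\bigcup_{m\ge 0} V_m$.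 Harmonic structure: a Laplacian on a finite set $V$ is a symmetric linear map $H:l(V)\to l(V)$ ($l(V)$ = real functions on $V$) that is non-positive definite, with $Hu=0$ iff $u$ is constant, and $H_{pq}\ge0$ for $p\ne q$; $\mathscr E_H(u,v)=-u^{\mathrm t}Hv$. Given a Laplacian $H_0$ on $V_0$ and $\mathbf r=(r_1,\dots,r_s)$, $r_i>0$, put $r_w=r_{w_1}\cdots r_{w_m}$, $\mathscr E_m(u,v)=\sum_{w\in W_m}r_w^{-1}\mathscr E_{H_0}(u\circ F_w,v\circ F_w)$ for $u,v\in l(V_m)$, and let $H_m$ be the Laplacian on $V_m$ with $\mathscr E_{H_m}=\mathscr E_m$. $(H_0,\mathbf r)$ is a harmonic structure if $\mathscr E_0(v,v)=\min\{\mathscr E_1(u,u):u\in l(V_1),u|_{V_0}=v\}$ for all $v\in l(V_0)$, and regular if $0<r_i<1$ for all $i$. Then $\mathscr E(u)=\lim_m\mathscr E_m(u|_{V_m},u|_{V_m})$, $\mathscr F=\{u:\mathscr E(u)<\infty\}\subset C(K)$. Laplacian: $\mu$ is the Borel probability measure with $\mu=\sum_i\mu_i\,\mu\circ F_i^{-1}$, where $\mu_i\in(0,1)$, $\sum_i\mu_i=1$. For $p\in V_m$, $\psi_{m,p}$ is the minimizer of $\mathscr E$ over $u\in\mathscr F$ with $u(p)=1$, $u=0$ on $V_m\setminus\{p\}$; $\mu_{m,p}=\int_K\psi_{m,p}\,\mathrm d\mu$. $u\in C(K)$ lies in $\mathscr D_\mu$ with $\Delta_\mu u=f\in C(K)$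 if $\lim_m\max_{p\in V_m\setminus V_0}|\mu_{m,p}^{-1}(H_mu)(p)-f(p)|=0$. For $u\in\mathscr D_\mu$, $p\in V_0$, the normal derivative is $(\mathrm du)_p=\lim_m-(H_mu)(p)$ (it exists). For $\lambda\ge0$, a $\lambda$-eigenfunction is a not identically zero $u\in\mathscr D_\mu$ with $-\Delta_\mu u=\lambda u$ on $K\setminus V_0$; it is Dirichlet if $u|_{V_0}=0$ and Neumann if $(\mathrm du)_p=0$ for all $p\in V_0$. With $\gamma_i=\sqrt{r_i\mu_i}$, the spectral dimension $d_S$ is the unique real number with $\sum_{i\in S}\gamma_i^{d_S}=1$. Extreme sets: for $u\in\mathscr D_\mu$, a nonempty $A\subset K$ is an extreme set of $u$ if for some $c\in\mathbb R$: $A$ is a connected component of $u^{-1}(c)$; $A\cap V_0=\emptyset$; and there is $\delta>0$ such that either $u\le c$ on the whole $\delta$-neighborhood $A_\delta$ of $A$ in $K$, or $u\ge c$ on all of $A_\delta$. $\mathrm{Extr}(u)$ is the set of extreme sets of $u$. For $x>0$, $\Gamma_D(x)$ (resp. $\Gamma_N(x)$) is the supremum of $\#\mathrm{Extr}(u_\lambda)$ over all Dirichlet (resp. Neumann) $\lambda$-eigenfunctions $u_\lambda$ with $0\le\lambda\le x$.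
   Formalization: The contractions F_i are additionally assumed injective on K (the standard convention for p.c.f. self-similar structures); without this a harmonic structure as defined may have no non-constant functions of finite energy, so ψ_{m,p} and the Laplacian can be undefined. *)

theory Defs
  imports "HOL-Probability.Probability"
begin

section \<open>Self-similar sets\<close>

text \<open>The symbols are \<open>{1..s}\<close>. Finite words are lists; an infinite word
  \<open>\<omega>\<^sub>1 \<omega>\<^sub>2 \<dots>\<close> is a function on \<^typ>\<open>nat\<close>, with \<open>\<omega> n\<close> standing for \<open>\<omega>\<^sub>n\<^sub>+\<^sub>1\<close>.\<close>

definition words :: "nat \<Rightarrow> nat \<Rightarrow> nat list set" where
  "words s m = {w. set w \<subseteq> {1..s} \<and> length w = m}"

definition inf_words :: "nat \<Rightarrow> (nat \<Rightarrow> nat) set" where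
  "inf_words s = UNIV \<rightarrow> {1..s}"

definition shift :: "(nat \<Rightarrow> nat) \<Rightarrow> nat \<Rightarrow> nat" where
  "shift \<omega> = (\<lambda>n. \<omega> (Suc n))"

primrec word_map :: "(nat \<Rightarrow> 'a \<Rightarrow> 'a) \<Rightarrow> nat list \<Rightarrow> 'a \<Rightarrow> 'a" where
  "word_map F [] = id"
| "word_map F (i # w) = F i \<circ> word_map F w"

definition word_prod :: "(nat \<Rightarrow> real) \<Rightarrow> nat list \<Rightarrow> real" where
  "word_prod r w = prod_list (map r w)"

text \<open>The ambient complete metric space is the type \<^typ>\<open>'a\<close>. By Hutchinson's theorem
  \<open>K\<close> is determined by \<open>F\<close>. Injectivity on \<open>K\<close> is the standing convention of
  Kigami's theory (a self-similar structure consists of continuous injections of \<open>K\<close>):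
  without it a harmonic structure in the sense below need not give
  compatible energies, and the functions \<open>\<psi>\<^sub>m\<^sub>,\<^sub>p\<close> need not exist.\<close>

definition self_similar_set ::
    "nat \<Rightarrow> (nat \<Rightarrow> 'a::complete_space \<Rightarrow> 'a) \<Rightarrow> 'a set \<Rightarrow> bool" where
  "self_similar_set s F K \<longleftrightarrow>
     s \<ge> 2 \<and>
     (\<forall>i\<in>{1..s}. \<exists>c<1. c-lipschitz_on UNIV (F i)) \<and>
     (\<forall>i\<in>{1..s}. inj_on (F i) K) \<and>
     compact K \<and> K \<noteq> {} \<and> K = (\<Union>i\<in>{1..s}. F i ` K)"

context
  fixes s :: nat and F :: "nat \<Rightarrow> 'a::complete_space \<Rightarrow> 'a" and K :: "'a set"
begin

definition coding :: "(nat \<Rightarrow> nat) \<Rightarrow> 'a" where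
  "coding \<omega> = (THE x. x \<in> (\<Inter>m\<in>{1..}. word_map F (map \<omega> [0..<m]) ` K))"

definition critical_set :: "(nat \<Rightarrow> nat) set" where
  "critical_set =
     {\<omega> \<in> inf_words s. coding \<omega> \<in>
        (\<Union>(i, j)\<in>{(i, j). i \<in> {1..s} \<and> j \<in> {1..s} \<and> i \<noteq> j}. F i ` K \<inter> F j ` K)}"

definition post_critical_set :: "(nat \<Rightarrow> nat) set" where
  "post_critical_set = (\<Union>m\<in>{1..}. (shift ^^ m) ` critical_set)"

definition pcf :: bool where
  "pcf \<longleftrightarrow> finite post_critical_set"

definition bdry :: "'a set" where
  "bdry = coding ` post_critical_set"

definition verts :: "nat \<Rightarrow> 'a set" where
  "verts m = (\<Union>w\<in>words s m. word_map F w ` bdry)"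

end


section \<open>Discrete Laplacians and harmonic structures\<close>

text \<open>A linear map on \<open>l(V)\<close> is given by its matrix \<open>H p q\<close> (\<open>p, q \<in> V\<close>); elements of \<open>l(V)\<close>
  are total functions of which only the values on \<open>V\<close> are used.\<close>

definition op_apply :: "'a set \<Rightarrow> ('a \<Rightarrow> 'a \<Rightarrow> real) \<Rightarrow> ('a \<Rightarrow> real) \<Rightarrow> 'a \<Rightarrow> real" where
  "op_apply V H u p = (\<Sum>q\<in>V. H p q * u q)"

definition dform :: "'a set \<Rightarrow> ('a \<Rightarrow> 'a \<Rightarrow> real) \<Rightarrow> ('a \<Rightarrow> real) \<Rightarrow> ('a \<Rightarrow> real) \<Rightarrow> real" where
  "dform V H u v = - (\<Sum>p\<in>V. u p * op_apply V H v p)"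

definition is_laplacian :: "'a set \<Rightarrow> ('a \<Rightarrow> 'a \<Rightarrow> real) \<Rightarrow> bool" where
  "is_laplacian V H \<longleftrightarrow>
     finite V \<and>
     (\<forall>p\<in>V. \<forall>q\<in>V. H p q = H q p) \<and>
     (\<forall>u. (\<Sum>p\<in>V. u p * op_apply V H u p) \<le> 0) \<and>
     (\<forall>u. (\<forall>p\<in>V. op_apply V H u p = 0) \<longleftrightarrow> (\<exists>c. \<forall>p\<in>V. u p = c)) \<and>
     (\<forall>p\<in>V. \<forall>q\<in>V. p \<noteq> q \<longrightarrow> H p q \<ge> 0)"

context
  fixes s :: nat and F :: "nat \<Rightarrow> 'a::complete_space \<Rightarrow> 'a" and K :: "'a set"
    and H :: "'a \<Rightarrow> 'a \<Rightarrow> real" and r :: "nat \<Rightarrow> real"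
begin

definition level_form :: "nat \<Rightarrow> ('a \<Rightarrow> real) \<Rightarrow> ('a \<Rightarrow> real) \<Rightarrow> real" where
  "level_form m u v =
     (\<Sum>w\<in>words s m. inverse (word_prod r w) *
        dform (bdry s F K) H (u \<circ> word_map F w) (v \<circ> word_map F w))"

text \<open>The matrix \<open>H\<^sub>m\<close> with \<open>\<E>\<^sub>H\<^sub>m = \<E>\<^sub>m\<close>; see \<open>dform_level_laplacian\<close> and
  \<open>level_laplacian_unique\<close> below.\<close>

definition level_laplacian :: "nat \<Rightarrow> 'a \<Rightarrow> 'a \<Rightarrow> real" where
  "level_laplacian m p q = - level_form m (indicator {p}) (indicator {q})"

definition harmonic_structure :: bool where
  "harmonic_structure \<longleftrightarrow>
     is_laplacian (bdry s F K) H \<and> (\<forall>i\<in>{1..s}. r i > 0) \<and>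
     (\<forall>v. (\<exists>u. (\<forall>p\<in>bdry s F K. u p = v p) \<and> level_form 1 u u = level_form 0 v v) \<and>
          (\<forall>u. (\<forall>p\<in>bdry s F K. u p = v p) \<longrightarrow> level_form 0 v v \<le> level_form 1 u u))"

definition regular_harmonic_structure :: bool where
  "regular_harmonic_structure \<longleftrightarrow> harmonic_structure \<and> (\<forall>i\<in>{1..s}. 0 < r i \<and> r i < 1)"

definition energy :: "('a \<Rightarrow> real) \<Rightarrow> ereal" where
  "energy u = lim (\<lambda>m. ereal (level_form m u u))"

definition energy_dom :: "('a \<Rightarrow> real) set" where
  "energy_dom = {u. continuous_on K u \<and> energy u < \<infinity>}"

text \<open>Functions on \<open>K\<close> are total functions, so the minimizer \<open>\<psi>\<^sub>m\<^sub>,\<^sub>p\<close> is unique only on \<open>K\<close>.\<close>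

definition tent :: "nat \<Rightarrow> 'a \<Rightarrow> 'a \<Rightarrow> real" where
  "tent m p = arg_min energy
     (\<lambda>u. u \<in> energy_dom \<and> u p = 1 \<and> (\<forall>q\<in>verts s F K m - {p}. u q = 0))"

end

lemma finite_words: "finite (words s m)"
  unfolding words_def by (rule finite_lists_length_eq) simp

lemma dform_expand: "dform V H u v = (\<Sum>x\<in>V. \<Sum>y\<in>V. - H x y * u x * v y)"
  unfolding dform_def op_apply_def
  by (simp add: sum_distrib_left sum_negf mult_ac)

lemma sum_swap3:
  "(\<Sum>q\<in>V. \<Sum>w\<in>W. \<Sum>x\<in>A. \<Sum>y\<in>B. f q w x y) = (\<Sum>w\<in>W. \<Sum>x\<in>A. \<Sum>y\<in>B. \<Sum>q\<in>V. f q w x y)"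
proof -
  have "(\<Sum>q\<in>V. \<Sum>w\<in>W. \<Sum>x\<in>A. \<Sum>y\<in>B. f q w x y) = (\<Sum>w\<in>W. \<Sum>q\<in>V. \<Sum>x\<in>A. \<Sum>y\<in>B. f q w x y)"
    by (rule sum.swap)
  also have "\<dots> = (\<Sum>w\<in>W. \<Sum>x\<in>A. \<Sum>q\<in>V. \<Sum>y\<in>B. f q w x y)"
    by (rule sum.cong[OF refl], rule sum.swap)
  also have "\<dots> = (\<Sum>w\<in>W. \<Sum>x\<in>A. \<Sum>y\<in>B. \<Sum>q\<in>V. f q w x y)"
    by (rule sum.cong[OF refl], rule sum.cong[OF refl], rule sum.swap)
  finally show ?thesis .
qed

lemma dform_level_laplacian:
  assumes "finite (bdry s F K)"
  shows "dform (verts s F K m) (level_laplacian s F K H r m) u v = level_form s F K H r m u v"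
proof -
  let ?V = "verts s F K m" and ?B = "bdry s F K"
  let ?c = "\<lambda>w. inverse (word_prod r w)"
  let ?g = "\<lambda>w. word_map F w"
  have fV: "finite ?V" unfolding verts_def using assms finite_words by blast
  have pick: "(\<Sum>p\<in>?V. f p * indicator {p} (?g w x)) = f (?g w x)"
    if "w \<in> words s m" "x \<in> ?B" for f :: "'a \<Rightarrow> real" and w x
  proof -
    have "?g w x \<in> ?V" using that unfolding verts_def by blast
    moreover have "(\<Sum>p\<in>?V. f p * indicator {p} (?g w x)) =
        (\<Sum>p\<in>?V. if p = ?g w x then f p else 0)"
      by (rule sum.cong) (auto simp: indicator_def)
    ultimately show ?thesis using fV by (simp add: sum.delta)
  qed
  let ?t = "\<lambda>p q w x y. ?c w * (- H x y * (u p * indicator {p} (?g w x)) * (v q * indicator {q} (?g w y)))"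
  have "dform ?V (level_laplacian s F K H r m) u v =
      (\<Sum>p\<in>?V. \<Sum>q\<in>?V. \<Sum>w\<in>words s m. \<Sum>x\<in>?B. \<Sum>y\<in>?B. ?t p q w x y)"
    unfolding dform_expand level_laplacian_def level_form_def
    by (simp add: sum_distrib_left sum_distrib_right sum_negf mult_ac o_def)
  also have "\<dots> = (\<Sum>p\<in>?V. \<Sum>w\<in>words s m. \<Sum>x\<in>?B. \<Sum>y\<in>?B. \<Sum>q\<in>?V. ?t p q w x y)"
    by (rule sum.cong[OF refl], rule sum_swap3)
  also have "\<dots> = (\<Sum>w\<in>words s m. \<Sum>x\<in>?B. \<Sum>y\<in>?B. \<Sum>p\<in>?V. \<Sum>q\<in>?V. ?t p q w x y)"
    by (rule sum_swap3)
  also have "\<dots> = (\<Sum>w\<in>words s m. \<Sum>x\<in>?B. \<Sum>y\<in>?B.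
      ?c w * (- H x y) * (\<Sum>p\<in>?V. u p * indicator {p} (?g w x)) *
        (\<Sum>q\<in>?V. v q * indicator {q} (?g w y)))"
    by (simp add: sum_distrib_left sum_distrib_right mult_ac flip: sum_negf)
  also have "\<dots> = (\<Sum>w\<in>words s m. \<Sum>x\<in>?B. \<Sum>y\<in>?B.
      ?c w * (- H x y * u (?g w x) * v (?g w y)))"
    by (intro sum.cong refl) (simp add: pick mult_ac)
  also have "\<dots> = level_form s F K H r m u v"
    unfolding level_form_def dform_expand by (simp add: sum_distrib_left sum_negf)
  finally show ?thesis .
qed

lemma level_laplacian_unique:
  assumes "finite V" and "\<And>u v. dform V A u v = dform V B u v" and "p \<in> V" "q \<in> V"
  shows "A p q = B p q"
proof -
  have "dform V C (indicator {p}) (indicator {q}) = - C p q" for C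
  proof -
    have "op_apply V C (indicator {q}) x = C x q" for x
    proof -
      have "op_apply V C (indicator {q}) x = (\<Sum>y\<in>V. if y = q then C x y else 0)"
        unfolding op_apply_def by (rule sum.cong) (auto simp: indicator_def)
      then show ?thesis using assms by (simp add: sum.delta)
    qed
    then have "dform V C (indicator {p}) (indicator {q}) = - (\<Sum>x\<in>V. if x = p then C x q else 0)"
      unfolding dform_def by (auto intro!: sum.cong simp: indicator_def)
    then show ?thesis using assms by (simp add: sum.delta)
  qed
  then show ?thesis using assms(2) by (metis neg_equal_iff_equal)
qed


section \<open>The Laplacian and its eigenfunctions\<close>

definition self_similar_measure ::
    "nat \<Rightarrow> (nat \<Rightarrow> 'a::complete_space \<Rightarrow> 'a) \<Rightarrow> 'a set \<Rightarrow> (nat \<Rightarrow> real) \<Rightarrow> 'a measure \<Rightarrow> bool" where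
  "self_similar_measure s F K \<mu> M \<longleftrightarrow>
     (\<forall>i\<in>{1..s}. 0 < \<mu> i \<and> \<mu> i < 1) \<and> (\<Sum>i\<in>{1..s}. \<mu> i) = 1 \<and>
     sets M = sets (restrict_space borel K) \<and> prob_space M \<and>
     (\<forall>A\<in>sets M. measure M A = (\<Sum>i\<in>{1..s}. \<mu> i * measure M (F i -` A \<inter> K)))"

definition spectral_dim :: "nat \<Rightarrow> (nat \<Rightarrow> real) \<Rightarrow> (nat \<Rightarrow> real) \<Rightarrow> real" where
  "spectral_dim s r \<mu> = (THE d. (\<Sum>i\<in>{1..s}. sqrt (r i * \<mu> i) powr d) = 1)"

context
  fixes s :: nat and F :: "nat \<Rightarrow> 'a::complete_space \<Rightarrow> 'a" and K :: "'a set"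
    and H :: "'a \<Rightarrow> 'a \<Rightarrow> real" and r :: "nat \<Rightarrow> real" and M :: "'a measure"
begin

definition tent_mass :: "nat \<Rightarrow> 'a \<Rightarrow> real" where
  "tent_mass m p = (\<integral>x. tent s F K H r m p x \<partial>M)"

definition level_apply :: "nat \<Rightarrow> ('a \<Rightarrow> real) \<Rightarrow> 'a \<Rightarrow> real" where
  "level_apply m u p = op_apply (verts s F K m) (level_laplacian s F K H r m) u p"

text \<open>\<open>u \<in> \<D>\<^sub>\<mu>\<close> and \<open>\<Delta>\<^sub>\<mu> u = f\<close> on \<open>K\<close>. The inserted \<open>0\<close> only matters where \<open>V\<^sub>m - V\<^sub>0\<close> is empty
  (in particular for \<open>m = 0\<close>).\<close>

definition has_laplacian :: "('a \<Rightarrow> real) \<Rightarrow> ('a \<Rightarrow> real) \<Rightarrow> bool" where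
  "has_laplacian u f \<longleftrightarrow>
     continuous_on K u \<and> continuous_on K f \<and>
     (\<lambda>m. Max (insert 0 ((\<lambda>p. \<bar>inverse (tent_mass m p) * level_apply m u p - f p\<bar>)
                ` (verts s F K m - bdry s F K)))) \<longlonglongrightarrow> 0"

definition has_normal_derivative :: "('a \<Rightarrow> real) \<Rightarrow> 'a \<Rightarrow> real \<Rightarrow> bool" where
  "has_normal_derivative u p d \<longleftrightarrow> (\<lambda>m. - level_apply m u p) \<longlonglongrightarrow> d"

definition eigenfunction :: "real \<Rightarrow> ('a \<Rightarrow> real) \<Rightarrow> bool" where
  "eigenfunction lam u \<longleftrightarrow>
     (\<exists>x\<in>K. u x \<noteq> 0) \<and>
     (\<exists>f. has_laplacian u f \<and> (\<forall>x\<in>K - bdry s F K. - f x = lam * u x))"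

definition dirichlet_eigenfunction :: "real \<Rightarrow> ('a \<Rightarrow> real) \<Rightarrow> bool" where
  "dirichlet_eigenfunction lam u \<longleftrightarrow> eigenfunction lam u \<and> (\<forall>p\<in>bdry s F K. u p = 0)"

definition neumann_eigenfunction :: "real \<Rightarrow> ('a \<Rightarrow> real) \<Rightarrow> bool" where
  "neumann_eigenfunction lam u \<longleftrightarrow>
     eigenfunction lam u \<and> (\<forall>p\<in>bdry s F K. has_normal_derivative u p 0)"

end


section \<open>Extreme sets and extremum counting functions\<close>

definition extreme_sets ::
    "nat \<Rightarrow> (nat \<Rightarrow> 'a::complete_space \<Rightarrow> 'a) \<Rightarrow> 'a set \<Rightarrow> ('a \<Rightarrow> real) \<Rightarrow> 'a set set" where
  "extreme_sets s F K u =
     {A. A \<noteq> {} \<and> (\<exists>c. A \<in> components {x\<in>K. u x = c} \<and> A \<inter> bdry s F K = {} \<and>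
           (\<exists>\<delta>>0. (\<forall>x\<in>K \<inter> (\<Union>a\<in>A. ball a \<delta>). u x \<le> c) \<or>
                  (\<forall>x\<in>K \<inter> (\<Union>a\<in>A. ball a \<delta>). u x \<ge> c)))}"

text \<open>Cardinalities live in \<open>[0, \<infinity>]\<close>: infinite sets count \<open>\<infinity>\<close>, and the supremum of the empty
  family is \<open>0\<close>.\<close>

definition num_extr ::
    "nat \<Rightarrow> (nat \<Rightarrow> 'a::complete_space \<Rightarrow> 'a) \<Rightarrow> 'a set \<Rightarrow> ('a \<Rightarrow> real) \<Rightarrow> ennreal" where
  "num_extr s F K u = emeasure (count_space UNIV) (extreme_sets s F K u)"

context
  fixes s :: nat and F :: "nat \<Rightarrow> 'a::complete_space \<Rightarrow> 'a" and K :: "'a set"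
    and H :: "'a \<Rightarrow> 'a \<Rightarrow> real" and r :: "nat \<Rightarrow> real" and M :: "'a measure"
begin

definition dirichlet_extr_count :: "real \<Rightarrow> ennreal" where
  "dirichlet_extr_count x =
     (SUP u\<in>{u. \<exists>lam. 0 \<le> lam \<and> lam \<le> x \<and> dirichlet_eigenfunction s F K H r M lam u}. num_extr s F K u)"

definition neumann_extr_count :: "real \<Rightarrow> ennreal" where
  "neumann_extr_count x =
     (SUP u\<in>{u. \<exists>lam. 0 \<le> lam \<and> lam \<le> x \<and> neumann_eigenfunction s F K H r M lam u}. num_extr s F K u)"

end

end

theory Submission
  imports Defs
begin

text \<open>Restricting an eigenfunction of eigenvalue \<open>lam\<close> to the cell \<open>F i ` K\<close> and rescaling it to \<open>K\<close>
  gives a solution of the eigenvalue equation with the smaller eigenvalue \<open>r i * \<mu> i * lam\<close>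
  (\<open>eigen_equation_cell\<close>), or the zero function. An extreme set that avoids the finite set \<open>V 1\<close> lies in
  a single cell, because it is connected and cells meet only in \<open>V 1\<close>; it is then an extreme set of the
  restriction. The extreme sets that meet \<open>V 1\<close> are pairwise disjoint, so there are at most
  \<open>card (V 1)\<close> of them. Hence the number of extreme sets of \<open>u\<close> is at most the sum of those of the
  restrictions plus a constant (\<open>num_extr_le_cells\<close>). Iterating until all eigenvalues are below
  \<open>lam0\<close>, where there is at most one extreme set, and using that the numbers \<open>r i * \<mu> i\<close> raised to
  half the spectral dimension add up to \<open>1\<close>, one gets the growth \<open>lam powr (d / 2)\<close>
  (\<open>num_extr_growth\<close>). This bound holds for all solutions of the eigenvalue equation, in particular for
  Dirichlet and for Neumann eigenfunctions.

  Most of the work goes into the scaling of the Laplacian. It is a limit of graph Laplacians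
  divided by the masses of the tent functions, and the graph Laplacians scale by \<open>1 / r i\<close> directly from
  the definition. The masses scale by \<open>\<mu> i\<close> once it is known that the tent function of level \<open>m + 1\<close>
  at \<open>F i p\<close> is the tent function of level \<open>m\<close> at \<open>p\<close> carried to the cell \<open>i\<close>, and zero
  on the other cells (\<open>tent_cell\<close>). This rests on existence and uniqueness of energy minimizers
  with prescribed values on \<open>V m\<close>. For existence (\<open>harmonic_extension_exists\<close>) one iterates the
  discrete minimization from \<open>V 0\<close> to \<open>V 1\<close>; the Poincare inequality on \<open>V 0\<close>
  together with \<open>r i < 1\<close> bounds the oscillation on cells of generation \<open>n\<close> by a
  geometric sequence, so the limit is continuous. For uniqueness (\<open>harmonic_above_unique\<close>), the difference of two
  minimizers has energy zero, and it vanishes because \<open>K\<close> is connected.\<close>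

section \<open>Geometry of the cells\<close>

locale pcf_set =
  fixes s :: nat and F :: "nat \<Rightarrow> 'a::complete_space \<Rightarrow> 'a" and K :: "'a set"
  assumes self_similar: "self_similar_set s F K"
    and connected_K: "connected K"
    and pcf: "pcf s F K"
begin

definition "S = {1..s}"

abbreviation "V \<equiv> verts s F K"
abbreviation "B \<equiv> bdry s F K"

lemma two_symbols: "s \<ge> 2"
  and inj_F: "i \<in> S \<Longrightarrow> inj_on (F i) K"
  and compact_K: "compact K"
  and K_nonempty: "K \<noteq> {}"
  and K_eq: "K = (\<Union>i\<in>S. F i ` K)"
  using self_similar unfolding self_similar_set_def S_def by auto

lemma finite_S: "finite S"
  unfolding S_def by simp

lemma one_in_S: "1 \<in> S" and two_in_S: "2 \<in> S"
  using two_symbols unfolding S_def by auto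

lemma inf_words_iff: "\<omega> \<in> inf_words s \<longleftrightarrow> (\<forall>n. \<omega> n \<in> S)"
  unfolding inf_words_def S_def by auto

lemma F_in_K: "i \<in> S \<Longrightarrow> x \<in> K \<Longrightarrow> F i x \<in> K"
  using K_eq by blast

lemma F_eq_iff: "i \<in> S \<Longrightarrow> x \<in> K \<Longrightarrow> y \<in> K \<Longrightarrow> F i x = F i y \<longleftrightarrow> x = y"
  using inj_F inj_on_eq_iff by metis

lemma K_cases:
  assumes "y \<in> K"
  obtains i x where "i \<in> S" "x \<in> K" "y = F i x"
  using assms K_eq by blast

lemma contraction_ratio:
  obtains c where "0 \<le> c" "c < 1"
    "\<And>i x y. i \<in> S \<Longrightarrow> dist (F i x) (F i y) \<le> c * dist x y"
proof -
  have "\<forall>i\<in>S. \<exists>c. c < 1 \<and> c-lipschitz_on UNIV (F i)"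
    using self_similar unfolding self_similar_set_def S_def by blast
  then obtain c where c: "\<And>i. i \<in> S \<Longrightarrow> c i < 1 \<and> (c i)-lipschitz_on UNIV (F i)"
    by metis
  show thesis
  proof
    show "0 \<le> Max (c ` S)"
      using lipschitz_on_nonneg c[OF one_in_S] one_in_S finite_S
      by (meson Max_ge finite_imageI image_eqI order_trans)
    show "Max (c ` S) < 1" using c one_in_S finite_S by (subst Max_less_iff) auto
    fix i x y assume i: "i \<in> S"
    have "dist (F i x) (F i y) \<le> c i * dist x y"
      using c[OF i] by (auto intro: lipschitz_onD)
    also have "\<dots> \<le> Max (c ` S) * dist x y"
      using i finite_S by (intro mult_right_mono Max_ge) auto
    finally show "dist (F i x) (F i y) \<le> Max (c ` S) * dist x y" .
  qed
qed

lemma dist_F_le: "i \<in> S \<Longrightarrow> dist (F i x) (F i y) \<le> dist x y"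
  by (rule contraction_ratio) (smt (verit) mult_left_le_one_le zero_le_dist)

lemma continuous_on_F: "i \<in> S \<Longrightarrow> continuous_on A (F i)"
  unfolding continuous_on_iff by (metis dist_F_le le_less_trans)

lemma compact_cell: "i \<in> S \<Longrightarrow> compact (F i ` K)"
  using compact_continuous_image continuous_on_F compact_K by blast

lemma closed_cells: "I \<subseteq> S \<Longrightarrow> closed (\<Union>i\<in>I. F i ` K)"
  using finite_subset[OF _ finite_S] compact_cell by (intro closed_UN ballI compact_imp_closed) auto

lemma continuous_on_cell_inverse:
  "i \<in> S \<Longrightarrow> continuous_on (F i ` K) (inv_into K (F i))"
  by (rule continuous_on_inv[OF continuous_on_F compact_K]) (auto simp: inj_F)

subsection \<open>The coding map\<close>

lemma word_map_image_K:
  "set w \<subseteq> S \<Longrightarrow> word_map F w ` K \<subseteq> K"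
  by (induction w) (auto simp: F_in_K image_subset_iff)

lemma word_map_append: "word_map F (v @ w) = word_map F v \<circ> word_map F w"
  by (induction v) auto

lemma continuous_on_word_map: "set w \<subseteq> S \<Longrightarrow> continuous_on A (word_map F w)"
proof (induction w arbitrary: A)
  case (Cons i w)
  then show ?case
    by (auto intro!: continuous_on_compose continuous_on_F simp del: comp_apply simp: word_map.simps)
qed (auto intro: continuous_intros)

lemma prefix_symbols: "\<omega> \<in> inf_words s \<Longrightarrow> set (map \<omega> [0..<m]) \<subseteq> S"
  by (auto simp: inf_words_iff)

text \<open>The cells along an infinite word are nested nonempty compact sets whose diameters tend
  to zero.\<close>

lemma coding_unique_point:
  assumes \<omega>: "\<omega> \<in> inf_words s"
  shows "\<exists>!x. x \<in> (\<Inter>m\<in>{1..}. word_map F (map \<omega> [0..<m]) ` K)"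
proof -
  let ?C = "\<lambda>m. word_map F (map \<omega> [0..<m]) ` K"
  have dec: "?C (Suc m) \<subseteq> ?C m" for m
    using \<omega> by (auto simp: word_map_append inf_words_iff F_in_K)
  have mono: "?C m \<subseteq> ?C n" if "n \<le> m" for m n
    using dec that by (rule lift_Suc_antimono_le)
  have closed: "closed (?C m)" for m
    using compact_continuous_image[OF continuous_on_word_map compact_K] prefix_symbols[OF \<omega>]
    by (blast intro: compact_imp_closed)
  have fip: "K \<inter> (\<Inter>m\<in>I. ?C m) \<noteq> {}" if "finite I" for I
  proof -
    have "?C (Max (insert 0 I)) \<subseteq> K \<inter> (\<Inter>m\<in>I. ?C m)"
      using that by (intro Int_greatest word_map_image_K prefix_symbols \<omega> INT_greatest mono Max_ge) auto
    then show ?thesis using K_nonempty by blast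
  qed
  have "K \<inter> (\<Inter>m. ?C m) \<noteq> {}"
    by (rule compact_imp_fip_image[OF compact_K closed fip])
  then obtain x where x: "\<And>m. x \<in> ?C m" by blast
  obtain c where c: "0 \<le> c" "c < 1"
    "\<And>i x y. i \<in> S \<Longrightarrow> dist (F i x) (F i y) \<le> c * dist x y"
    using contraction_ratio by metis
  have shrink: "dist (word_map F w x) (word_map F w y) \<le> c ^ length w * dist x y"
    if "set w \<subseteq> S" for w x y
    using that
  proof (induction w)
    case (Cons i w)
    then have "dist (word_map F (i # w) x) (word_map F (i # w) y)
      \<le> c * (c ^ length w * dist x y)"
      using c(3)[of i "word_map F w x" "word_map F w y"] mult_left_mono[OF Cons.IH c(1)] by fastforce
    then show ?case by (simp add: mult.assoc)
  qed simp
  have "y = x" if y: "y \<in> (\<Inter>m\<in>{1..}. ?C m)" for y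
  proof -
    have "dist x y \<le> c ^ m * diameter K" if "m \<ge> 1" for m
    proof -
      have "y \<in> ?C m" using y that by simp
      then obtain a b where ab: "a \<in> K" "b \<in> K" "x = word_map F (map \<omega> [0..<m]) a"
        "y = word_map F (map \<omega> [0..<m]) b"
        using x[of m] by (elim imageE)
      have "dist x y \<le> c ^ m * dist a b"
        unfolding ab using shrink[OF prefix_symbols[OF \<omega>], of m a b] by simp
      also have "\<dots> \<le> c ^ m * diameter K"
        using c ab compact_K by (intro mult_left_mono diameter_bounded_bound compact_imp_bounded) auto
      finally show ?thesis .
    qed
    moreover have "(\<lambda>m. c ^ m * diameter K) \<longlonglongrightarrow> 0 * diameter K"
      using c by (intro tendsto_intros LIMSEQ_power_zero) auto
    ultimately have "dist x y \<le> 0"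
      by (intro LIMSEQ_le_const) auto
    then show ?thesis by simp
  qed
  then show ?thesis using x by blast
qed

lemma coding_in: "\<omega> \<in> inf_words s \<Longrightarrow> coding F K \<omega> \<in> word_map F (map \<omega> [0..<m]) ` K"
proof -
  assume \<omega>: "\<omega> \<in> inf_words s"
  have *: "coding F K \<omega> \<in> (\<Inter>m\<in>{1..}. word_map F (map \<omega> [0..<m]) ` K)"
    unfolding coding_def by (rule theI'[OF coding_unique_point[OF \<omega>]])
  show ?thesis
  proof (cases "m = 0")
    case True
    then show ?thesis using * word_map_image_K[OF prefix_symbols[OF \<omega>, of 1]] by force
  qed (use * in auto)
qed

lemma coding_in_K: "\<omega> \<in> inf_words s \<Longrightarrow> coding F K \<omega> \<in> K"
  using coding_in[of \<omega> 0] by simp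

lemma coding_eqI:
  "\<omega> \<in> inf_words s \<Longrightarrow> (\<And>m. m \<ge> 1 \<Longrightarrow> x \<in> word_map F (map \<omega> [0..<m]) ` K) \<Longrightarrow> coding F K \<omega> = x"
  using coding_unique_point[of \<omega>] coding_in[of \<omega>] by blast

lemma coding_case_nat:
  assumes i: "i \<in> S" and \<omega>: "\<omega> \<in> inf_words s"
  shows "case_nat i \<omega> \<in> inf_words s" "coding F K (case_nat i \<omega>) = F i (coding F K \<omega>)"
proof -
  show \<tau>: "case_nat i \<omega> \<in> inf_words s"
    using assms by (auto simp: inf_words_iff split: nat.splits)
  have pre: "map (case_nat i \<omega>) [0..<m] = i # map \<omega> [0..<m - 1]" if "m \<ge> 1" for m
    using that by (intro nth_equalityI) (auto simp: nth_Cons split: nat.splits)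
  show "coding F K (case_nat i \<omega>) = F i (coding F K \<omega>)"
    using coding_in[OF \<omega>] by (intro coding_eqI[OF \<tau>]) (auto simp: pre simp flip: image_image)
qed

lemma shift_case_nat [simp]: "shift (case_nat i \<omega>) = \<omega>"
  by (simp add: shift_def fun_eq_iff)

lemma case_nat_shift: "case_nat (\<omega> 0) (shift \<omega>) = \<omega>"
  by (auto simp: shift_def fun_eq_iff split: nat.splits)

lemma shift_in: "\<omega> \<in> inf_words s \<Longrightarrow> shift \<omega> \<in> inf_words s"
  by (auto simp: shift_def inf_words_iff)

lemma coding_shift: "\<omega> \<in> inf_words s \<Longrightarrow> coding F K \<omega> = F (\<omega> 0) (coding F K (shift \<omega>))"
  using coding_case_nat(2)[OF _ shift_in, of "\<omega> 0" \<omega>] case_nat_shift[of \<omega>]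
  by (auto simp: inf_words_iff)

text \<open>Follow a point backwards: every point of \<open>K\<close> has a preimage in \<open>K\<close> under one of the maps, and the
  symbols met in this way form a code.\<close>

lemma coding_surj:
  assumes "x \<in> K"
  obtains \<omega> where "\<omega> \<in> inf_words s" "coding F K \<omega> = x"
proof -
  have "\<forall>y\<in>K. \<exists>i z. i \<in> S \<and> z \<in> K \<and> y = F i z" using K_cases by metis
  then obtain sym pre where sp: "\<And>y. y \<in> K \<Longrightarrow> sym y \<in> S" "\<And>y. y \<in> K \<Longrightarrow> pre y \<in> K"
    "\<And>y. y \<in> K \<Longrightarrow> F (sym y) (pre y) = y"
    by metis
  define \<omega> where "\<omega> n = sym ((pre ^^ n) x)" for n
  have inK: "(pre ^^ n) x \<in> K" for n
    by (induction n) (use assms sp in auto)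
  then have \<omega>: "\<omega> \<in> inf_words s" using sp(1) by (simp add: inf_words_iff \<omega>_def)
  have "x = word_map F (map \<omega> [0..<m]) ((pre ^^ m) x)" for m
    by (induction m) (use sp(3)[OF inK] in \<open>auto simp: word_map_append \<omega>_def\<close>)
  then have "x \<in> word_map F (map \<omega> [0..<m]) ` K" for m
    using inK by blast
  then show thesis using coding_eqI[OF \<omega>] \<omega> that by metis
qed

subsection \<open>The boundary and the vertices\<close>

lemma post_critical_inf_words: "post_critical_set s F K \<subseteq> inf_words s"
proof -
  have "(shift ^^ m) \<omega> \<in> inf_words s" if "\<omega> \<in> inf_words s" for m \<omega>
    using that by (induction m) (auto simp: shift_in)
  then show ?thesis unfolding post_critical_set_def critical_set_def by auto
qed

lemma finite_B: "finite B"
  using pcf unfolding pcf_def bdry_def by simp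

lemma B_subset_K: "B \<subseteq> K"
  using post_critical_inf_words coding_in_K unfolding bdry_def by blast

text \<open>Cells meet only at images of the boundary: a code of \<open>x\<close> with \<open>i\<close> put in front is critical,
  since its point lies in two cells, and its shift is the code of \<open>x\<close>.\<close>

lemma overlap_in_B:
  assumes "i \<in> S" "j \<in> S" "i \<noteq> j" "x \<in> K" "y \<in> K" "F i x = F j y"
  shows "x \<in> B"
proof -
  obtain \<omega> where \<omega>: "\<omega> \<in> inf_words s" "coding F K \<omega> = x" using coding_surj assms by metis
  have "F i x \<in> F i ` K \<inter> F j ` K" using assms by (metis IntI image_eqI)
  then have "case_nat i \<omega> \<in> critical_set s F K"
    using coding_case_nat[OF assms(1) \<omega>(1)] assms \<omega> unfolding critical_set_def S_def by auto
  then have "shift (case_nat i \<omega>) \<in> post_critical_set s F K"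
    unfolding post_critical_set_def by (force intro: bexI[of _ 1])
  then show ?thesis using \<omega> unfolding bdry_def by auto
qed

lemma B_cases:
  assumes "p \<in> B"
  obtains i q where "i \<in> S" "q \<in> B" "p = F i q"
proof -
  obtain \<omega> where \<omega>: "\<omega> \<in> post_critical_set s F K" "p = coding F K \<omega>"
    using assms unfolding bdry_def by auto
  then have \<omega>': "\<omega> \<in> inf_words s" using post_critical_inf_words by auto
  obtain m \<tau> where "m \<ge> 1" "\<tau> \<in> critical_set s F K" "\<omega> = (shift ^^ m) \<tau>"
    using \<omega>(1) unfolding post_critical_set_def by auto
  then have "Suc m \<in> {1..}" "shift \<omega> = (shift ^^ Suc m) \<tau>" by auto
  then have "shift \<omega> \<in> post_critical_set s F K"
    using \<open>\<tau> \<in> critical_set s F K\<close> unfolding post_critical_set_def by blast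
  then show thesis
    using that[of "\<omega> 0" "coding F K (shift \<omega>)"] coding_shift[OF \<omega>'] \<omega> \<omega>'
    unfolding bdry_def inf_words_iff by auto
qed

text \<open>Without boundary points the cells would be pairwise disjoint closed sets, and \<open>K\<close> would not be connected.\<close>

lemma B_nonempty: "B \<noteq> {}"
proof
  assume e: "B = {}"
  note 1 = one_in_S two_in_S
  let ?R = "\<Union>j\<in>S - {1}. F j ` K"
  have "K \<subseteq> F 1 ` K \<union> ?R" using K_eq by blast
  moreover have "F 1 ` K \<inter> ?R = {}" using overlap_in_B[OF 1(1)] e by fastforce
  moreover have "closed (F 1 ` K)" "closed ?R"
    using closed_cells[of "{1}"] closed_cells[of "S - {1}"] 1 by auto
  ultimately have "F 1 ` K \<inter> K = {} \<or> ?R \<inter> K = {}"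
    by (intro connected_closedD[OF connected_K]) auto
  moreover obtain x where "x \<in> K" using K_nonempty by blast
  moreover have "2 \<in> S - {1}" using 1 by simp
  ultimately have "F 1 x \<in> F 1 ` K \<inter> K" "F 2 x \<in> ?R \<inter> K" using 1 F_in_K by blast+
  then show False using \<open>_ \<or> _\<close> by blast
qed

lemma words_0: "words s 0 = {[]}"
  unfolding words_def by auto

lemma words_Suc: "words s (Suc n) = (\<lambda>(i, w). i # w) ` (S \<times> words s n)"
  unfolding words_def S_def by (auto simp: length_Suc_conv image_iff)

lemma sum_words_Suc:
  "(\<Sum>w\<in>words s (Suc n). f w) = (\<Sum>i\<in>S. \<Sum>w\<in>words s n. f (i # w))"
  unfolding words_Suc sum.cartesian_product
  by (subst sum.reindex) (auto simp: inj_on_def intro!: sum.cong)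

lemma V_0: "V 0 = B"
  unfolding verts_def words_0 by simp

lemma V_Suc: "V (Suc m) = (\<Union>i\<in>S. F i ` V m)"
proof -
  have *: "words s (Suc m) = (\<Union>i\<in>S. (#) i ` words s m)" by (auto simp: words_Suc)
  show ?thesis unfolding verts_def * UN_UN_flatten by (simp add: image_UN image_comp)
qed

lemma V_subset_K: "V m \<subseteq> K"
proof (induction m)
  case 0
  then show ?case using B_subset_K by (simp add: V_0)
next
  case (Suc m)
  then show ?case using F_in_K by (auto simp: V_Suc)
qed

lemma finite_V: "finite (V m)"
  by (induction m) (auto simp: V_0 V_Suc finite_B finite_S)

lemma B_subset_V1: "B \<subseteq> V (Suc 0)"
proof
  fix p assume "p \<in> B"
  then show "p \<in> V (Suc 0)" by (rule B_cases) (auto simp: V_Suc V_0)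
qed

lemma V_mono_Suc: "V m \<subseteq> V (Suc m)"
proof (induction m)
  case 0
  then show ?case using B_subset_V1 by (simp add: V_0)
next
  case (Suc m)
  then show ?case by (subst (1 2) V_Suc) blast
qed

lemma B_subset_V: "B \<subseteq> V m"
proof (induction m)
  case (Suc m)
  then show ?case using V_mono_Suc by blast
qed (simp add: V_0)

text \<open>The vertices of a cell are the images of vertices: a vertex coming from another cell lies in the overlap,
  where \<open>overlap_in_B\<close> applies.\<close>

lemma in_V_of_F_in_V:
  assumes "i \<in> S" "x \<in> K" "F i x \<in> V (Suc m)"
  shows "x \<in> V m"
proof -
  obtain j y where jy: "j \<in> S" "y \<in> V m" "F i x = F j y" using assms(3) by (auto simp: V_Suc)
  then have "y \<in> K" using V_subset_K by blast
  show ?thesis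
  proof (cases "i = j")
    case True
    then have "x = y" using jy \<open>y \<in> K\<close> assms F_eq_iff by metis
    then show ?thesis using jy by simp
  next
    case False
    then have "x \<in> B" using overlap_in_B jy \<open>y \<in> K\<close> assms by metis
    then show ?thesis using B_subset_V by blast
  qed
qed

lemma in_B_of_F_in_B: "i \<in> S \<Longrightarrow> x \<in> K \<Longrightarrow> F i x \<in> B \<Longrightarrow> x \<in> B"
  using in_V_of_F_in_V[of i x 0] B_subset_V1 V_0 by auto

lemma vertices_dense:
  assumes "x \<in> K" "e > 0"
  obtains m y where "y \<in> V m" "dist x y < e"
proof -
  obtain c where c: "0 \<le> c" "c < 1"
    "\<And>i x y. i \<in> S \<Longrightarrow> dist (F i x) (F i y) \<le> c * dist x y"
    using contraction_ratio by metis
  have near: "\<exists>y\<in>V m. dist x y \<le> c ^ m * diameter K" if "x \<in> K" for x m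
    using that
  proof (induction m arbitrary: x)
    case 0
    then show ?case using B_nonempty B_subset_K compact_K
      by (auto simp: V_0 intro!: diameter_bounded_bound compact_imp_bounded)
  next
    case (Suc m)
    obtain i z where z: "i \<in> S" "z \<in> K" "x = F i z" using Suc.prems K_cases by metis
    obtain y where y: "y \<in> V m" "dist z y \<le> c ^ m * diameter K" using Suc.IH z by blast
    have "dist x (F i y) \<le> c * (c ^ m * diameter K)"
      using c(3)[OF z(1), of z y] mult_left_mono[OF y(2) c(1)] z by simp
    then show ?case using y z by (auto simp: V_Suc mult.assoc)
  qed
  have "(\<lambda>m. c ^ m * diameter K) \<longlonglongrightarrow> 0 * diameter K"
    using c by (intro tendsto_intros LIMSEQ_power_zero) auto
  then obtain m where "c ^ m * diameter K < e"
    using order_tendstoD(2)[of _ 0 sequentially e] \<open>e > 0\<close> by (auto simp: eventually_sequentially)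
  then show thesis using near[OF assms(1), of m] that by force
qed

end


section \<open>Dirichlet forms on finite sets\<close>

lemma dform_cong:
  "(\<And>p. p \<in> V \<Longrightarrow> u p = u' p) \<Longrightarrow> (\<And>p. p \<in> V \<Longrightarrow> v p = v' p) \<Longrightarrow> dform V H u v = dform V H u' v'"
  unfolding dform_expand by (intro sum.cong refl) simp

lemma dform_parallelogram:
  "dform V H (\<lambda>x. (u x + v x) / 2) (\<lambda>x. (u x + v x) / 2) + dform V H (\<lambda>x. u x - v x) (\<lambda>x. u x - v x) / 4
    = (dform V H u u + dform V H v v) / 2"
  unfolding dform_expand sum.distrib[symmetric] sum_divide_distrib
  by (intro sum.cong refl) (simp add: field_simps)

locale finite_laplacian =
  fixes V :: "'a set" and H :: "'a \<Rightarrow> 'a \<Rightarrow> real"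
  assumes laplacian: "is_laplacian V H"
begin

lemma finite_V: "finite V"
  and sym: "p \<in> V \<Longrightarrow> q \<in> V \<Longrightarrow> H p q = H q p"
  and off_diagonal: "p \<in> V \<Longrightarrow> q \<in> V \<Longrightarrow> p \<noteq> q \<Longrightarrow> H p q \<ge> 0"
  and dform_nonneg: "dform V H u u \<ge> 0"
  using laplacian unfolding is_laplacian_def dform_def by (auto simp: minus_le_iff)

lemma harmonic_iff_constant: "(\<forall>p\<in>V. op_apply V H u p = 0) \<longleftrightarrow> (\<exists>c. \<forall>p\<in>V. u p = c)"
  using laplacian unfolding is_laplacian_def by blast

lemma row_sum: "p \<in> V \<Longrightarrow> (\<Sum>q\<in>V. H p q) = 0"
  using harmonic_iff_constant[of "\<lambda>_. 1"] by (auto simp: op_apply_def)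

lemma dform_eq_sum_squares:
  "dform V H u u = (\<Sum>p\<in>V. \<Sum>q\<in>V. H p q * (u p - u q)\<^sup>2) / 2"
proof -
  have "(\<Sum>p\<in>V. \<Sum>q\<in>V. H p q * (u p)\<^sup>2) = 0"
    by (simp add: row_sum flip: sum_distrib_right)
  moreover have "(\<Sum>p\<in>V. \<Sum>q\<in>V. H p q * (u q)\<^sup>2) = (\<Sum>q\<in>V. \<Sum>p\<in>V. H q p * (u q)\<^sup>2)"
    by (subst sum.swap) (intro sum.cong refl, simp add: sym)
  then have "(\<Sum>p\<in>V. \<Sum>q\<in>V. H p q * (u q)\<^sup>2) = 0"
    by (simp add: row_sum flip: sum_distrib_right)
  moreover have "(\<Sum>p\<in>V. \<Sum>q\<in>V. H p q * (u p - u q)\<^sup>2) =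
      (\<Sum>p\<in>V. \<Sum>q\<in>V. H p q * (u p)\<^sup>2) + (\<Sum>p\<in>V. \<Sum>q\<in>V. H p q * (u q)\<^sup>2) + 2 * dform V H u u"
    unfolding dform_expand sum_distrib_left sum.distrib[symmetric]
    by (intro sum.cong refl) (simp add: power2_eq_square algebra_simps)
  ultimately show ?thesis by simp
qed

lemma dform_contraction:
  assumes "\<And>p q. p \<in> V \<Longrightarrow> q \<in> V \<Longrightarrow> \<bar>v p - v q\<bar> \<le> \<bar>u p - u q\<bar>"
  shows "dform V H v v \<le> dform V H u u"
proof -
  have "H p q * (v p - v q)\<^sup>2 \<le> H p q * (u p - u q)\<^sup>2" if "p \<in> V" "q \<in> V" for p q
    using assms[OF that] off_diagonal[OF that]
    by (cases "p = q") (auto intro!: mult_left_mono simp: abs_le_square_iff)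
  then show ?thesis
    unfolding dform_eq_sum_squares by (intro divide_right_mono sum_mono) auto
qed

lemma edge_le_dform:
  assumes "p \<in> V" "q \<in> V"
  shows "H p q * (u p - u q)\<^sup>2 \<le> 2 * dform V H u u"
proof -
  have nonneg: "H x y * (u x - u y)\<^sup>2 \<ge> 0" if "x \<in> V" "y \<in> V" for x y
    using off_diagonal[OF that] by (cases "x = y") auto
  have "H p q * (u p - u q)\<^sup>2 \<le> (\<Sum>y\<in>V. H p y * (u p - u y)\<^sup>2)"
    using nonneg assms finite_V by (intro member_le_sum) auto
  also have "\<dots> \<le> (\<Sum>x\<in>V. \<Sum>y\<in>V. H x y * (u x - u y)\<^sup>2)"
    using nonneg assms finite_V
    by (intro member_le_sum[where f = "\<lambda>x. \<Sum>y\<in>V. H x y * (u x - u y)\<^sup>2"] sum_nonneg) auto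
  finally show ?thesis unfolding dform_eq_sum_squares by simp
qed

text \<open>Fix \<open>p\<close>. The points \<open>x\<close> for which \<open>u p - u x\<close> is controlled by the energy are closed under passing to
  a neighbour in the graph of the positive weights \<open>H x y\<close>, because the increment along a single edge
  is controlled. So their indicator function is harmonic, hence constant.\<close>

lemma poincare_pair:
  assumes "p \<in> V" "q \<in> V"
  shows "\<exists>C\<ge>0. \<forall>u. (u p - u q)\<^sup>2 \<le> C * dform V H u u"
proof -
  define R where "R = {x\<in>V. \<exists>C\<ge>0. \<forall>u. (u p - u x)\<^sup>2 \<le> C * dform V H u u}"
  have step: "y \<in> R" if x: "x \<in> R" and y: "y \<in> V" "H x y > 0" for x y
  proof -
    obtain C where C: "C \<ge> 0" "\<And>u. (u p - u x)\<^sup>2 \<le> C * dform V H u u"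
      using x unfolding R_def by blast
    have "(u p - u y)\<^sup>2 \<le> (2 * C + 4 / H x y) * dform V H u u" for u
    proof -
      have "(a + b)\<^sup>2 \<le> 2 * a\<^sup>2 + 2 * b\<^sup>2" for a b :: real
        using zero_le_power2[of "a - b"] by (simp add: power2_eq_square algebra_simps)
      from this[of "u p - u x" "u x - u y"]
      have "(u p - u y)\<^sup>2 \<le> 2 * (u p - u x)\<^sup>2 + 2 * (u x - u y)\<^sup>2" by simp
      moreover have "(u x - u y)\<^sup>2 \<le> 2 / H x y * dform V H u u"
        using edge_le_dform[of x y u] x y unfolding R_def by (simp add: field_simps)
      ultimately show ?thesis using C(2)[of u] by (simp add: algebra_simps)
    qed
    moreover have "0 \<le> 2 * C + 4 / H x y" using C(1) y(2) by simp
    ultimately show ?thesis using y(1) unfolding R_def by blast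
  qed
  have "op_apply V H (indicator R) x = 0" if x: "x \<in> V" for x
  proof (cases "x \<in> R")
    case True
    have "op_apply V H (indicator R) x = (\<Sum>y\<in>V. H x y) - (\<Sum>y\<in>V. H x y * (1 - indicator R y))"
      by (simp add: op_apply_def sum_subtractf right_diff_distrib)
    moreover have "H x y * (1 - indicator R y) = 0" if "y \<in> V" for y
      using step[OF True that] off_diagonal[OF x that] True by (cases "y \<in> R"; cases "x = y") force+
    ultimately show ?thesis using row_sum[OF x] by simp
  next
    case False
    have "H x y * indicator R y = 0" if "y \<in> V" for y
      using step[of y x] off_diagonal[OF x that] sym[OF x that] False x by (cases "y \<in> R"; cases "x = y") force+
    then show ?thesis unfolding op_apply_def by (intro sum.neutral ballI)
  qed
  then obtain c where c: "\<And>x. x \<in> V \<Longrightarrow> indicator R x = (c::real)"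
    using harmonic_iff_constant[of "indicator R"] by auto
  have "\<exists>C\<ge>0. \<forall>u. (u p - u p)\<^sup>2 \<le> C * dform V H u u" by (intro exI[of _ 0]) simp
  then have "p \<in> R" using assms unfolding R_def by blast
  then have "q \<in> R" using c[OF assms(1)] c[OF assms(2)] by (simp add: indicator_def split: if_splits)
  then show ?thesis unfolding R_def by blast
qed

lemma poincare:
  obtains C where "C \<ge> 0" "\<And>u p q. p \<in> V \<Longrightarrow> q \<in> V \<Longrightarrow> (u p - u q)\<^sup>2 \<le> C * dform V H u u"
proof -
  have "\<exists>C. \<forall>p\<in>V. \<forall>q\<in>V. C p q \<ge> 0 \<and> (\<forall>u. (u p - u q)\<^sup>2 \<le> C p q * dform V H u u)"
    using poincare_pair by metis
  then obtain C where C: "\<And>p q. p \<in> V \<Longrightarrow> q \<in> V \<Longrightarrow> C p q \<ge> 0"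
    "\<And>p q u. p \<in> V \<Longrightarrow> q \<in> V \<Longrightarrow> (u p - u q)\<^sup>2 \<le> C p q * dform V H u u"
    by metis
  show thesis
  proof
    show "(\<Sum>p\<in>V. \<Sum>q\<in>V. C p q) \<ge> 0" using C(1) by (intro sum_nonneg) auto
    fix u p q assume pq: "p \<in> V" "q \<in> V"
    have "C p q \<le> (\<Sum>q\<in>V. C p q)"
      using pq C(1) finite_V by (intro member_le_sum) auto
    also have "\<dots> \<le> (\<Sum>p\<in>V. \<Sum>q\<in>V. C p q)"
      using pq C(1) finite_V by (intro member_le_sum[where f = "\<lambda>p. \<Sum>q\<in>V. C p q"] sum_nonneg) auto
    finally show "(u p - u q)\<^sup>2 \<le> (\<Sum>p\<in>V. \<Sum>q\<in>V. C p q) * dform V H u u"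
      by (rule order_trans[OF C(2)[OF pq] mult_right_mono[OF _ dform_nonneg]])
  qed
qed

end

section \<open>The energies on the vertex sets\<close>

locale harmonic_set = pcf_set s F K
  for s :: nat and F :: "nat \<Rightarrow> 'a::complete_space \<Rightarrow> 'a" and K :: "'a set" +
  fixes H :: "'a \<Rightarrow> 'a \<Rightarrow> real" and r :: "nat \<Rightarrow> real"
  assumes regular: "regular_harmonic_structure s F K H r"

sublocale harmonic_set \<subseteq> lap: finite_laplacian "bdry s F K" H
  using regular unfolding regular_harmonic_structure_def harmonic_structure_def
  by unfold_locales blast

context harmonic_set
begin

abbreviation "E \<equiv> level_form s F K H r"

lemma r_pos: "i \<in> S \<Longrightarrow> r i > 0" and r_less_1: "i \<in> S \<Longrightarrow> r i < 1"
  using regular unfolding regular_harmonic_structure_def S_def by auto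

lemma level_form_0: "E 0 u v = dform B H u v"
  unfolding level_form_def words_0 by (simp add: word_prod_def)

lemma level_form_Suc: "E (Suc m) u v = (\<Sum>i\<in>S. E m (u \<circ> F i) (v \<circ> F i) / r i)"
  unfolding level_form_def sum_words_Suc
  by (intro sum.cong refl) (simp add: word_prod_def sum_distrib_left sum_divide_distrib comp_assoc field_simps)

lemma level_form_cong:
  assumes "\<And>p. p \<in> V m \<Longrightarrow> u p = u' p" "\<And>p. p \<in> V m \<Longrightarrow> v p = v' p"
  shows "E m u v = E m u' v'"
proof -
  have "word_map F w p \<in> V m" if "w \<in> words s m" "p \<in> B" for w p
    using that unfolding verts_def by blast
  then show ?thesis
    unfolding level_form_def
    by (intro sum.cong refl arg_cong2[of _ _ _ _ "(*)"] dform_cong) (auto intro!: assms)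
qed

lemma level_form_cong_K:
  "(\<And>x. x \<in> K \<Longrightarrow> u x = u' x) \<Longrightarrow> (\<And>x. x \<in> K \<Longrightarrow> v x = v' x) \<Longrightarrow> E m u v = E m u' v'"
  using V_subset_K by (intro level_form_cong) blast+

lemma level_form_nonneg: "E m u u \<ge> 0"
proof (induction m arbitrary: u)
  case 0
  then show ?case by (simp add: level_form_0 lap.dform_nonneg)
next
  case (Suc m)
  then show ?case unfolding level_form_Suc using r_pos by (intro sum_nonneg divide_nonneg_pos) auto
qed

lemma level_form_contraction:
  assumes "\<And>x y. \<bar>v x - v y\<bar> \<le> \<bar>u x - u y\<bar>"
  shows "E m v v \<le> E m u u"
  using assms
proof (induction m arbitrary: u v)
  case 0
  then show ?case unfolding level_form_0 by (intro lap.dform_contraction)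
next
  case (Suc m)
  then show ?case unfolding level_form_Suc
    using r_pos by (intro sum_mono divide_right_mono Suc.IH) (auto simp: less_imp_le)
qed

lemma level_form_parallelogram:
  "E m (\<lambda>x. (u x + v x) / 2) (\<lambda>x. (u x + v x) / 2) + E m (\<lambda>x. u x - v x) (\<lambda>x. u x - v x) / 4
    = (E m u u + E m v v) / 2"
proof (induction m arbitrary: u v)
  case 0
  then show ?case unfolding level_form_0 by (rule dform_parallelogram)
next
  case (Suc m)
  show ?case unfolding level_form_Suc sum_divide_distrib sum.distrib[symmetric]
  proof (intro sum.cong refl)
    fix i assume "i \<in> S"
    show "E m ((\<lambda>x. (u x + v x) / 2) \<circ> F i) ((\<lambda>x. (u x + v x) / 2) \<circ> F i) / r i +
         E m ((\<lambda>x. u x - v x) \<circ> F i) ((\<lambda>x. u x - v x) \<circ> F i) / r i / 4 =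
         (E m (u \<circ> F i) (u \<circ> F i) / r i + E m (v \<circ> F i) (v \<circ> F i) / r i) / 2"
      using arg_cong[OF Suc[of "u \<circ> F i" "v \<circ> F i"], of "\<lambda>x. x / r i"]
      by (simp add: o_def add_divide_distrib)
  qed
qed

lemma cell_form_le:
  assumes "i \<in> S"
  shows "E m (u \<circ> F i) (u \<circ> F i) \<le> r i * E (Suc m) u u"
proof -
  have "E m (u \<circ> F i) (u \<circ> F i) / r i \<le> E (Suc m) u u"
    unfolding level_form_Suc using assms r_pos level_form_nonneg finite_S
    by (intro member_le_sum[where f = "\<lambda>i. E m (u \<circ> F i) (u \<circ> F i) / r i"] divide_nonneg_pos) auto
  then show ?thesis using r_pos[OF assms] by (simp add: field_simps)
qed

text \<open>The harmonic structure gives the step from \<open>V 0\<close> to \<open>V 1\<close>; the others are this step inside each cell.\<close>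

lemma level_form_le_Suc: "E m u u \<le> E (Suc m) u u"
proof (induction m arbitrary: u)
  case 0
  then show ?case using regular unfolding regular_harmonic_structure_def harmonic_structure_def by auto
next
  case (Suc m)
  show ?case unfolding level_form_Suc[of "Suc m" u u] level_form_Suc[of m u u]
    using r_pos by (intro sum_mono divide_right_mono Suc) (auto simp: less_imp_le)
qed

lemma level_form_mono: "m \<le> n \<Longrightarrow> E m u u \<le> E n u u"
  by (rule lift_Suc_mono_le[where f = "\<lambda>m. E m u u"], rule level_form_le_Suc)

lemma energy_eq_SUP: "energy s F K H r u = (SUP m. ereal (E m u u))"
  unfolding energy_def
  by (intro limI LIMSEQ_SUP) (auto simp: incseq_def level_form_mono)

lemma level_form_le_energy: "ereal (E m u u) \<le> energy s F K H r u"
  unfolding energy_eq_SUP by (rule SUP_upper) simp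

text \<open>Clamping a minimizer to the range of its boundary values does not increase its energy, so
  the extension to \<open>V 1\<close> can be chosen to obey the maximum principle.\<close>

lemma extension_exists:
  "\<exists>u. (\<forall>p\<in>B. u p = v p) \<and> E 1 u u = E 0 v v \<and>
     (\<forall>a b x. (\<forall>p\<in>B. a \<le> v p \<and> v p \<le> b) \<longrightarrow> a \<le> u x \<and> u x \<le> b)"
proof -
  have min: "(\<exists>u. (\<forall>p\<in>B. u p = v p) \<and> E 1 u u = E 0 v v) \<and>
      (\<forall>u. (\<forall>p\<in>B. u p = v p) \<longrightarrow> E 0 v v \<le> E 1 u u)"
    using regular unfolding regular_harmonic_structure_def harmonic_structure_def by blast
  then obtain u where u: "\<And>p. p \<in> B \<Longrightarrow> u p = v p" "E 1 u u = E 0 v v" by blast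
  define a b where "a = Min (v ` B)" and "b = Max (v ` B)"
  define t where "t x = max a (min b (u x))" for x
  have ab: "a \<le> v p \<and> v p \<le> b" if "p \<in> B" for p
    using that finite_B unfolding a_def b_def by simp
  have t: "\<forall>p\<in>B. t p = v p" using ab u(1) by (fastforce simp: t_def)
  have "E 1 t t \<le> E 1 u u"
    by (rule level_form_contraction) (auto simp: t_def max_def min_def)
  then have "E 1 t t = E 0 v v" using min t u(2) by (simp add: order_antisym)
  moreover have "a' \<le> t x \<and> t x \<le> b'" if "\<forall>p\<in>B. a' \<le> v p \<and> v p \<le> b'" for a' b' x
  proof -
    have "a' \<le> a" "b \<le> b'" "a \<le> b"
      using that B_nonempty finite_B ab unfolding a_def b_def by (auto simp: ex_in_conv[symmetric] intro: order_trans)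
    then show ?thesis by (auto simp: t_def)
  qed
  ultimately show ?thesis using t by blast
qed

definition extension :: "('a \<Rightarrow> real) \<Rightarrow> 'a \<Rightarrow> real" where
  "extension v = (SOME u. (\<forall>p\<in>B. u p = v p) \<and> E 1 u u = E 0 v v \<and>
     (\<forall>a b x. (\<forall>p\<in>B. a \<le> v p \<and> v p \<le> b) \<longrightarrow> a \<le> u x \<and> u x \<le> b))"

lemma extension_on_B: "p \<in> B \<Longrightarrow> extension v p = v p"
  and extension_energy: "E (Suc 0) (extension v) (extension v) = E 0 v v"
  and extension_bounds: "\<forall>p\<in>B. a \<le> v p \<and> v p \<le> b \<Longrightarrow> a \<le> extension v x \<and> extension v x \<le> b"
  using someI_ex[OF extension_exists, of v, folded extension_def] by (metis One_nat_def)+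

end


section \<open>Harmonic functions\<close>

text \<open>Continuity up to an error \<open>e\<close>. It passes from the cells to \<open>K\<close> with the same \<open>e\<close>, which allows
  one to prove continuity of a limit by induction on the generation of the cells.\<close>

definition oscillation_le :: "'a::metric_space set \<Rightarrow> real \<Rightarrow> ('a \<Rightarrow> real) \<Rightarrow> bool" where
  "oscillation_le K e g \<longleftrightarrow> (\<forall>x\<in>K. \<exists>d>0. \<forall>y\<in>K. dist y x < d \<longrightarrow> \<bar>g y - g x\<bar> \<le> e)"

lemma continuous_on_iff_oscillation:
  "continuous_on K g \<longleftrightarrow> (\<forall>e>0. oscillation_le K e g)"
proof
  assume "continuous_on K g"
  then show "\<forall>e>0. oscillation_le K e g"
    unfolding continuous_on_iff oscillation_le_def dist_real_def by (meson less_imp_le)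
next
  assume osc: "\<forall>e>0. oscillation_le K e g"
  show "continuous_on K g"
    unfolding continuous_on_iff dist_real_def
  proof (intro ballI allI impI)
    fix x and e :: real assume "x \<in> K" "e > 0"
    then obtain d where "d > 0" "\<And>y. y \<in> K \<Longrightarrow> dist y x < d \<Longrightarrow> \<bar>g y - g x\<bar> \<le> e / 2"
      using osc unfolding oscillation_le_def by (meson half_gt_zero)
    then show "\<exists>d>0. \<forall>y\<in>K. dist y x < d \<longrightarrow> \<bar>g y - g x\<bar> < e"
      using \<open>e > 0\<close> by (intro exI[of _ d]) force
  qed
qed

lemma oscillation_le_mono: "oscillation_le K e g \<Longrightarrow> e \<le> e' \<Longrightarrow> oscillation_le K e' g"
  unfolding oscillation_le_def by (meson order_trans)

context pcf_set
begin

text \<open>A point of \<open>K\<close> has a neighbourhood that meets only those cells that contain it, and each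
  cell is homeomorphic to \<open>K\<close>.\<close>

lemma oscillation_le_cells:
  assumes osc: "\<And>i. i \<in> S \<Longrightarrow> oscillation_le K e (g \<circ> F i)"
  shows "oscillation_le K e g"
  unfolding oscillation_le_def
proof
  fix x assume x: "x \<in> K"
  have "\<exists>d>0. \<forall>z\<in>K. dist (F i z) x < d \<longrightarrow> \<bar>g (F i z) - g x\<bar> \<le> e" if i: "i \<in> S" for i
  proof (cases "x \<in> F i ` K")
    case True
    then obtain x' where x': "x' \<in> K" "x = F i x'" by blast
    obtain d' where d': "d' > 0" "\<And>z. z \<in> K \<Longrightarrow> dist z x' < d' \<Longrightarrow> \<bar>g (F i z) - g (F i x')\<bar> \<le> e"
      using osc[OF i] x'(1) unfolding oscillation_le_def comp_apply by meson
    obtain d where d: "d > 0" "\<And>y. y \<in> F i ` K \<Longrightarrow> dist y x < d \<Longrightarrow>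
        dist (inv_into K (F i) y) (inv_into K (F i) x) < d'"
      using continuous_on_cell_inverse[OF i] True d'(1) unfolding continuous_on_iff by meson
    have "\<bar>g (F i z) - g x\<bar> \<le> e" if "z \<in> K" "dist (F i z) x < d" for z
      using d(2)[of "F i z"] d'(2)[of z] that x' inj_F[OF i] by simp
    then show ?thesis using d(1) by blast
  next
    case False
    have "open (- (F i ` K))" using compact_imp_closed[OF compact_cell[OF i]] by blast
    then obtain d where "d > 0" "ball x d \<subseteq> - (F i ` K)"
      using False openE by (metis ComplI)
    then have "\<not> dist (F i z) x < d" if "z \<in> K" for z
      using that by (auto simp: dist_commute)
    then show ?thesis using \<open>d > 0\<close> by blast
  qed
  then obtain d where d: "\<And>i. i \<in> S \<Longrightarrow> d i > 0"
    "\<And>i z. i \<in> S \<Longrightarrow> z \<in> K \<Longrightarrow> dist (F i z) x < d i \<Longrightarrow> \<bar>g (F i z) - g x\<bar> \<le> e"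
    by metis
  have "S \<noteq> {}" using one_in_S by blast
  have "Min (d ` S) > 0" using d(1) finite_S \<open>S \<noteq> {}\<close> by simp
  moreover have "\<bar>g y - g x\<bar> \<le> e" if "y \<in> K" "dist y x < Min (d ` S)" for y
  proof -
    obtain i z where z: "i \<in> S" "z \<in> K" "y = F i z" using K_cases \<open>y \<in> K\<close> by metis
    have "Min (d ` S) \<le> d i" using z finite_S by simp
    then show ?thesis using d(2) z that by simp
  qed
  ultimately show "\<exists>d>0. \<forall>y\<in>K. dist y x < d \<longrightarrow> \<bar>g y - g x\<bar> \<le> e" by blast
qed

lemma continuous_on_cells:
  fixes g :: "'a \<Rightarrow> real"
  assumes "\<And>i. i \<in> S \<Longrightarrow> continuous_on K (g \<circ> F i)"
  shows "continuous_on K g"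
  unfolding continuous_on_iff_oscillation
proof (intro allI impI)
  fix e :: real assume "e > 0"
  show "oscillation_le K e g"
    by (rule oscillation_le_cells) (use assms \<open>e > 0\<close> in \<open>simp only: continuous_on_iff_oscillation\<close>)
qed

lemma continuous_on_comp_F: "continuous_on K g \<Longrightarrow> i \<in> S \<Longrightarrow> continuous_on K (g \<circ> F i)"
  using F_in_K by (intro continuous_on_compose continuous_on_F) (auto elim: continuous_on_subset)

text \<open>A choice of one of the finitely many representations \<open>y = F i x\<close>. By \<open>glue_cell\<close> the choice does not
  matter for functions that agree where cells meet.\<close>

definition address :: "'a \<Rightarrow> nat \<times> 'a" where
  "address y = (SOME q. fst q \<in> S \<and> snd q \<in> K \<and> y = F (fst q) (snd q))"

definition glue :: "(nat \<Rightarrow> 'a \<Rightarrow> real) \<Rightarrow> 'a \<Rightarrow> real" where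
  "glue g y = g (fst (address y)) (snd (address y))"

lemma glue_cell:
  assumes compat: "\<And>i j x y. i \<in> S \<Longrightarrow> j \<in> S \<Longrightarrow> x \<in> B \<Longrightarrow> y \<in> B \<Longrightarrow> F i x = F j y \<Longrightarrow> g i x = g j y"
    and i: "i \<in> S" and x: "x \<in> K"
  shows "glue g (F i x) = g i x"
proof -
  define j z where "j = fst (address (F i x))" and "z = snd (address (F i x))"
  have "\<exists>q. fst q \<in> S \<and> snd q \<in> K \<and> F i x = F (fst q) (snd q)" using i x by force
  from someI_ex[OF this, folded address_def]
  have j: "j \<in> S" "z \<in> K" "F i x = F j z" unfolding j_def z_def by auto
  have "g j z = g i x"
  proof (cases "i = j")
    case True
    then show ?thesis using F_eq_iff[OF i x j(2)] j by simp
  next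
    case False
    then have "x \<in> B" "z \<in> B"
      using overlap_in_B[OF i j(1) False x j(2,3)] overlap_in_B[OF j(1) i _ j(2) x j(3)[symmetric]] by auto
    then show ?thesis using compat[OF i j(1)] j(3) by simp
  qed
  then show ?thesis unfolding glue_def j_def z_def .
qed

end

context harmonic_set
begin

text \<open>Harmonic extension of \<open>v\<close> from \<open>B\<close>, refined through \<open>n\<close> generations of cells. Off the
  vertices the approximation takes some value from the range of \<open>v\<close> on the boundary of the cell.\<close>

primrec approx :: "nat \<Rightarrow> ('a \<Rightarrow> real) \<Rightarrow> 'a \<Rightarrow> real" where
  "approx 0 v = (\<lambda>y. if y \<in> B then v y else v (SOME p. p \<in> B))"
| "approx (Suc n) v = glue (\<lambda>i. approx n (extension v \<circ> F i))"

text \<open>Both statements have to be proved at once: the functions that are glued agree on overlaps because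
  each of them has the prescribed boundary values.\<close>

lemma approx_boundary_and_cells:
  "(\<forall>p\<in>B. approx n v p = v p) \<and>
   (\<forall>i\<in>S. \<forall>x\<in>K. approx (Suc n) v (F i x) = approx n (extension v \<circ> F i) x)"
proof (induction n arbitrary: v)
  case 0
  have "approx (Suc 0) v (F i x) = approx 0 (extension v \<circ> F i) x" if "i \<in> S" "x \<in> K" for i x
    unfolding approx.simps(2) using that by (rule glue_cell[rotated]) simp
  then show ?case by simp
next
  case (Suc n)
  have B: "approx (Suc n) v p = v p" if p: "p \<in> B" for p v
  proof -
    obtain i q where q: "i \<in> S" "q \<in> B" "p = F i q" using p B_cases by metis
    then have "approx (Suc n) v p = approx n (extension v \<circ> F i) q" using Suc B_subset_K by blast
    also have "\<dots> = extension v p" using Suc q by simp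
    finally show ?thesis using extension_on_B p by simp
  qed
  have "approx (Suc (Suc n)) v (F i x) = approx (Suc n) (extension v \<circ> F i) x"
    if "i \<in> S" "x \<in> K" for i x
    unfolding approx.simps(2)[of "Suc n"] using that by (intro glue_cell) (simp_all only: B comp_apply)
  then show ?case using B by blast
qed

declare approx.simps [simp del]

lemma approx_on_B: "p \<in> B \<Longrightarrow> approx n v p = v p"
  and approx_cell: "i \<in> S \<Longrightarrow> x \<in> K \<Longrightarrow> approx (Suc n) v (F i x) = approx n (extension v \<circ> F i) x"
  using approx_boundary_and_cells by blast+

lemma approx_bounds:
  "\<forall>p\<in>B. a \<le> v p \<and> v p \<le> b \<Longrightarrow> x \<in> K \<Longrightarrow> a \<le> approx n v x \<and> approx n v x \<le> b"
proof (induction n arbitrary: v x)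
  case 0
  have "(SOME p. p \<in> B) \<in> B" using B_nonempty by (simp add: some_in_eq)
  then show ?case using 0 by (simp add: approx.simps)
next
  case (Suc n)
  obtain i z where z: "i \<in> S" "z \<in> K" "x = F i z" using Suc.prems(2) K_cases by metis
  have "\<forall>p\<in>B. a \<le> (extension v \<circ> F i) p \<and> (extension v \<circ> F i) p \<le> b"
    using extension_bounds[OF Suc.prems(1)] by simp
  from Suc.IH[OF this z(2)] show ?case unfolding z(3) approx_cell[OF z(1,2)] .
qed

text \<open>Regularity of the harmonic structure enters through \<open>max_ratio < 1\<close>.\<close>

definition max_ratio :: real where "max_ratio = Max (r ` S)"

lemma max_ratio: "0 \<le> max_ratio" "max_ratio < 1" "i \<in> S \<Longrightarrow> r i \<le> max_ratio"
proof -
  have *: "r i \<le> max_ratio" if "i \<in> S" for i using that finite_S unfolding max_ratio_def by simp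
  show "0 \<le> max_ratio" using *[OF one_in_S] r_pos[OF one_in_S] by simp
  show "max_ratio < 1" using finite_S one_in_S r_less_1 unfolding max_ratio_def by (subst Max_less_iff) auto
  show "i \<in> S \<Longrightarrow> r i \<le> max_ratio" by (rule *)
qed

lemma extension_cell_energy:
  assumes "i \<in> S"
  shows "E 0 (extension v \<circ> F i) (extension v \<circ> F i) \<le> max_ratio * E 0 v v"
proof -
  have "E 0 (extension v \<circ> F i) (extension v \<circ> F i) \<le> r i * E 0 v v"
    using cell_form_le[OF assms, of 0 "extension v"] extension_energy by simp
  also have "\<dots> \<le> max_ratio * E 0 v v"
    using max_ratio(3)[OF assms] level_form_nonneg by (intro mult_right_mono)
  finally show ?thesis .
qed

definition poincare_const :: real where
  "poincare_const = (SOME C. C \<ge> 0 \<and> (\<forall>u p q. p \<in> B \<longrightarrow> q \<in> B \<longrightarrow> (u p - u q)\<^sup>2 \<le> C * E 0 u u))"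

lemma poincare_const: "poincare_const \<ge> 0"
    "p \<in> B \<Longrightarrow> q \<in> B \<Longrightarrow> (u p - u q)\<^sup>2 \<le> poincare_const * E 0 u u"
proof -
  obtain C where "C \<ge> 0" "\<And>u p q. p \<in> B \<Longrightarrow> q \<in> B \<Longrightarrow> (u p - u q)\<^sup>2 \<le> C * dform B H u u"
    using lap.poincare by metis
  then have "\<exists>C. C \<ge> 0 \<and> (\<forall>u p q. p \<in> B \<longrightarrow> q \<in> B \<longrightarrow> (u p - u q)\<^sup>2 \<le> C * E 0 u u)"
    unfolding level_form_0 by blast
  from someI_ex[OF this, folded poincare_const_def]
  show "poincare_const \<ge> 0"
    "p \<in> B \<Longrightarrow> q \<in> B \<Longrightarrow> (u p - u q)\<^sup>2 \<le> poincare_const * E 0 u u"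
    by auto
qed

lemma constant_on_B_if_energy_0: "E 0 u u = 0 \<Longrightarrow> p \<in> B \<Longrightarrow> q \<in> B \<Longrightarrow> u p = u q"
  using poincare_const(2)[of p q u] by simp

lemma approx_range:
  assumes "x \<in> K" "y \<in> K"
  shows "\<bar>approx n v x - approx k v y\<bar> \<le> sqrt (poincare_const * E 0 v v)"
proof -
  define a b where "a = Min (v ` B)" and "b = Max (v ` B)"
  have "\<forall>p\<in>B. a \<le> v p \<and> v p \<le> b" using finite_B unfolding a_def b_def by simp
  note bnd = approx_bounds[OF this]
  have "a \<in> v ` B" "b \<in> v ` B"
    unfolding a_def b_def using finite_B B_nonempty by (intro Min_in Max_in; simp)+
  then obtain p q where "p \<in> B" "q \<in> B" "a = v p" "b = v q" by blast
  then have "(b - a)\<^sup>2 \<le> poincare_const * E 0 v v" using poincare_const(2) by simp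
  then have "b - a \<le> sqrt (poincare_const * E 0 v v)" by (rule real_le_rsqrt)
  then show ?thesis using bnd[OF assms(1), of n] bnd[OF assms(2), of k] by linarith
qed

lemma sqrt_cell_bound:
  assumes "i \<in> S"
  shows "sqrt (poincare_const * max_ratio ^ n * E 0 (extension v \<circ> F i) (extension v \<circ> F i))
    \<le> sqrt (poincare_const * max_ratio ^ Suc n * E 0 v v)"
proof -
  have "poincare_const * max_ratio ^ n * E 0 (extension v \<circ> F i) (extension v \<circ> F i)
    \<le> poincare_const * max_ratio ^ n * (max_ratio * E 0 v v)"
    using max_ratio poincare_const by (intro mult_left_mono extension_cell_energy assms) auto
  then show ?thesis by (simp add: mult_ac)
qed

text \<open>On a cell of generation \<open>n\<close> both approximations lie in the range of the same boundary values, whose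
  energy is at most \<open>max_ratio ^ n\<close> times that of \<open>v\<close>.\<close>

lemma approx_Cauchy_bound:
  "x \<in> K \<Longrightarrow> \<bar>approx n v x - approx (n + k) v x\<bar> \<le> sqrt (poincare_const * max_ratio ^ n * E 0 v v)"
proof (induction n arbitrary: v x)
  case 0
  then show ?case using approx_range[of x x 0 v k] by simp
next
  case (Suc n)
  obtain i z where z: "i \<in> S" "z \<in> K" "x = F i z" using Suc.prems K_cases by metis
  show ?case
    using order_trans[OF Suc.IH[OF z(2)] sqrt_cell_bound[OF z(1)]]
    unfolding z(3) add_Suc approx_cell[OF z(1,2)] .
qed

lemma poincare_decay:
  assumes "e > 0"
  obtains n where "sqrt (poincare_const * max_ratio ^ n * E 0 v v) < e"
proof -
  have "(\<lambda>n. sqrt (poincare_const * max_ratio ^ n * E 0 v v)) \<longlonglongrightarrow> sqrt (poincare_const * 0 * E 0 v v)"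
    using max_ratio by (intro tendsto_intros LIMSEQ_power_zero) auto
  then have "eventually (\<lambda>n. sqrt (poincare_const * max_ratio ^ n * E 0 v v) < e) sequentially"
    using order_tendstoD(2)[of _ 0 sequentially e] assms by simp
  then show thesis using that by (auto dest: eventually_happens)
qed

definition harmonic :: "('a \<Rightarrow> real) \<Rightarrow> 'a \<Rightarrow> real" where
  "harmonic v x = lim (\<lambda>n. approx n v x)"

lemma approx_tendsto: "x \<in> K \<Longrightarrow> (\<lambda>n. approx n v x) \<longlonglongrightarrow> harmonic v x"
proof -
  assume x: "x \<in> K"
  have "Cauchy (\<lambda>n. approx n v x)"
    unfolding Cauchy_altdef2
  proof (intro allI impI)
    fix e :: real assume "e > 0"
    then obtain N where "sqrt (poincare_const * max_ratio ^ N * E 0 v v) < e"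
      using poincare_decay by metis
    then have "\<bar>approx N v x - approx (N + k) v x\<bar> < e" for k
      using approx_Cauchy_bound[OF x, of N v k] by simp
    then have "\<forall>n\<ge>N. dist (approx n v x) (approx N v x) < e"
      by (metis dist_real_def abs_minus_commute le_Suc_ex)
    then show "\<exists>N. \<forall>n\<ge>N. dist (approx n v x) (approx N v x) < e" by blast
  qed
  then show ?thesis
    unfolding harmonic_def by (simp add: Cauchy_convergent_iff convergent_LIMSEQ_iff)
qed

lemma harmonic_on_B: "p \<in> B \<Longrightarrow> harmonic v p = v p"
  unfolding harmonic_def by (simp add: approx_on_B)

lemma harmonic_cell:
  assumes "i \<in> S" "x \<in> K"
  shows "harmonic v (F i x) = harmonic (extension v \<circ> F i) x"
proof -
  have "(\<lambda>n. approx (Suc n) v (F i x)) \<longlonglongrightarrow> harmonic v (F i x)"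
    using approx_tendsto[OF F_in_K[OF assms]] by (rule LIMSEQ_Suc)
  then show ?thesis
    unfolding approx_cell[OF assms] using approx_tendsto[OF assms(2)] LIMSEQ_unique by blast
qed

lemma harmonic_oscillation:
  "oscillation_le K (sqrt (poincare_const * max_ratio ^ n * E 0 v v)) (harmonic v)"
proof (induction n arbitrary: v)
  case 0
  have "\<bar>harmonic v y - harmonic v x\<bar> \<le> sqrt (poincare_const * E 0 v v)" if "x \<in> K" "y \<in> K" for x y
  proof (rule LIMSEQ_le_const2)
    show "(\<lambda>n. \<bar>approx n v y - approx n v x\<bar>) \<longlonglongrightarrow> \<bar>harmonic v y - harmonic v x\<bar>"
      using that by (intro tendsto_intros approx_tendsto)
    show "\<exists>N. \<forall>n\<ge>N. \<bar>approx n v y - approx n v x\<bar> \<le> sqrt (poincare_const * E 0 v v)"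
      using approx_range that by blast
  qed
  then show ?case unfolding oscillation_le_def by (auto intro!: exI[of _ 1])
next
  case (Suc n)
  show ?case
  proof (rule oscillation_le_cells)
    fix i assume i: "i \<in> S"
    have "oscillation_le K (sqrt (poincare_const * max_ratio ^ Suc n * E 0 v v)) (harmonic (extension v \<circ> F i))"
      by (rule oscillation_le_mono[OF Suc sqrt_cell_bound[OF i]])
    then show "oscillation_le K (sqrt (poincare_const * max_ratio ^ Suc n * E 0 v v)) (harmonic v \<circ> F i)"
      unfolding oscillation_le_def by (simp add: harmonic_cell[OF i])
  qed
qed

lemma continuous_on_harmonic: "continuous_on K (harmonic v)"
  unfolding continuous_on_iff_oscillation
proof (intro allI impI)
  fix e :: real assume "e > 0"
  then obtain n where "sqrt (poincare_const * max_ratio ^ n * E 0 v v) < e"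
    using poincare_decay by metis
  then show "oscillation_le K e (harmonic v)"
    using oscillation_le_mono[OF harmonic_oscillation] by (meson less_imp_le)
qed

lemma harmonic_energy: "E n (harmonic v) (harmonic v) = E 0 v v"
proof (induction n arbitrary: v)
  case 0
  then show ?case using harmonic_on_B by (intro level_form_cong) (auto simp: V_0)
next
  case (Suc n)
  have "E n (harmonic v \<circ> F i) (harmonic v \<circ> F i) = E 0 (extension v \<circ> F i) (extension v \<circ> F i)"
    if "i \<in> S" for i
    unfolding Suc[of "extension v \<circ> F i", symmetric]
    using harmonic_cell[OF that] by (intro level_form_cong_K) auto
  then show ?case
    unfolding extension_energy[of v, symmetric] level_form_Suc by (intro sum.cong refl) simp
qed

text \<open>For \<open>m > 0\<close> the extensions on the cells are glued; they agree on overlaps, since the latter consist of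
  vertices.\<close>

lemma harmonic_extension_exists:
  "\<exists>u. continuous_on K u \<and> (\<forall>p\<in>V m. u p = v p) \<and> (\<forall>n\<ge>m. E n u u = E m v v)"
proof (induction m arbitrary: v)
  case 0
  show ?case
    using continuous_on_harmonic harmonic_on_B harmonic_energy by (intro exI[of _ "harmonic v"]) (auto simp: V_0)
next
  case (Suc m)
  have "\<forall>i. \<exists>u. continuous_on K u \<and> (\<forall>p\<in>V m. u p = (v \<circ> F i) p) \<and>
      (\<forall>n\<ge>m. E n u u = E m (v \<circ> F i) (v \<circ> F i))"
    using Suc by blast
  then obtain g where g: "\<And>i. continuous_on K (g i)" "\<And>i p. p \<in> V m \<Longrightarrow> g i p = v (F i p)"
    "\<And>i n. n \<ge> m \<Longrightarrow> E n (g i) (g i) = E m (v \<circ> F i) (v \<circ> F i)"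
    unfolding comp_apply by metis
  have cell: "glue g (F i x) = g i x" if "i \<in> S" "x \<in> K" for i x
    using that g(2) B_subset_V[of m] by (intro glue_cell) (auto simp: subset_iff)
  have "continuous_on K (glue g)"
  proof (rule continuous_on_cells)
    fix i assume "i \<in> S"
    then show "continuous_on K (glue g \<circ> F i)"
      using g(1)[of i] cell by (subst continuous_on_cong[OF refl]) auto
  qed
  moreover have "glue g p = v p" if "p \<in> V (Suc m)" for p
    using that V_subset_K[of m] cell g(2) by (auto simp: V_Suc subset_iff)
  moreover have "E n (glue g) (glue g) = E (Suc m) v v" if "n \<ge> Suc m" for n
  proof -
    obtain k where k: "n = Suc k" "k \<ge> m" using \<open>n \<ge> Suc m\<close> by (cases n) auto
    have "E k (glue g \<circ> F i) (glue g \<circ> F i) = E m (v \<circ> F i) (v \<circ> F i)" if "i \<in> S" for i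
      unfolding g(3)[OF k(2), symmetric] using cell[OF that] by (intro level_form_cong_K) auto
    then show ?thesis unfolding k(1) level_form_Suc by (intro sum.cong refl) simp
  qed
  ultimately show ?case by blast
qed

text \<open>If \<open>u\<close> is constant on the boundary of every cell, these constants agree for
  cells that meet; as \<open>K\<close> is connected, all of them agree.\<close>

lemma zero_on_V1:
  assumes "\<And>p. p \<in> B \<Longrightarrow> u p = 0" "E (Suc 0) u u = 0" "p \<in> V (Suc 0)"
  shows "u p = 0"
proof -
  obtain b where b: "b \<in> B" using B_nonempty by blast
  have cell: "u (F i x) = u (F i y)" if "i \<in> S" "x \<in> B" "y \<in> B" for i x y
  proof -
    have "E 0 (u \<circ> F i) (u \<circ> F i) \<le> 0" using cell_form_le[OF that(1), of 0 u] assms(2) by simp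
    then have "E 0 (u \<circ> F i) (u \<circ> F i) = 0" using level_form_nonneg by (intro order_antisym)
    from constant_on_B_if_energy_0[OF this that(2,3)] show ?thesis by simp
  qed
  obtain j q where j: "j \<in> S" "q \<in> B" "p = F j q" using assms(3) by (auto simp: V_Suc V_0)
  obtain k z where k: "k \<in> S" "z \<in> B" "b = F k z" using b B_cases by metis
  define I where "I = {i\<in>S. u (F i b) = u (F j b)}"
  let ?A = "\<Union>i\<in>I. F i ` K" and ?C = "\<Union>i\<in>S - I. F i ` K"
  have "?A \<inter> ?C \<inter> K = {}"
  proof -
    have False if i: "i \<in> I" "i' \<in> S - I" "x \<in> K" "x' \<in> K" "F i x = F i' x'" for i i' x x'
    proof -
      have "i \<in> S" "i' \<in> S" "i \<noteq> i'" using i unfolding I_def by auto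
      then have "x \<in> B" "x' \<in> B"
        using overlap_in_B[of i i' x x'] overlap_in_B[of i' i x' x] i by auto
      then have "u (F i b) = u (F i' b)"
        using cell[OF \<open>i \<in> S\<close> \<open>x \<in> B\<close> b] cell[OF \<open>i' \<in> S\<close> \<open>x' \<in> B\<close> b] i(5) by simp
      then show False using i(1,2) unfolding I_def by simp
    qed
    then show ?thesis by blast
  qed
  moreover have "K \<subseteq> ?A \<union> ?C"
  proof
    fix x assume "x \<in> K"
    then obtain i y where "i \<in> S" "y \<in> K" "x = F i y" using K_cases by metis
    then show "x \<in> ?A \<union> ?C" by (cases "i \<in> I") auto
  qed
  moreover have "closed ?A" "closed ?C"
    by (intro closed_cells; auto simp: I_def)+
  ultimately have "?A \<inter> K = {} \<or> ?C \<inter> K = {}"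
    by (intro connected_closedD[OF connected_K])
  moreover have "b \<in> K" using b B_subset_K by blast
  moreover have "F j b \<in> ?A \<inter> K" using j(1) \<open>b \<in> K\<close> F_in_K unfolding I_def by auto
  ultimately have "F k b \<notin> ?C" using F_in_K[OF k(1) \<open>b \<in> K\<close>] by blast
  then have "k \<in> I" using k(1) \<open>b \<in> K\<close> by blast
  then have "u (F k b) = u (F j b)" unfolding I_def by simp
  moreover have "u (F k b) = u b" using cell[OF k(1) b k(2)] k(3) by simp
  ultimately show "u p = 0" using cell[OF j(1) b j(2)] j(3) assms(1)[OF b] by simp
qed

text \<open>The hypotheses pass to the cells by \<open>zero_on_V1\<close>, so \<open>u\<close> vanishes at all vertices, and these are
  dense.\<close>

lemma zero_if_energy_0:
  assumes "continuous_on K u" "\<And>p. p \<in> B \<Longrightarrow> u p = 0" "\<And>n. E n u u = 0" "x \<in> K"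
  shows "u x = 0"
proof -
  have vert: "u p = 0" if "p \<in> V n" "\<And>p. p \<in> B \<Longrightarrow> u p = 0" "\<And>n. E n u u = 0" for p n u
    using that
  proof (induction n arbitrary: u p)
    case 0
    then show ?case by (simp add: V_0)
  next
    case (Suc n)
    obtain i q where i: "i \<in> S" "q \<in> V n" "p = F i q" using Suc.prems(1) by (auto simp: V_Suc)
    have "(u \<circ> F i) q = 0"
    proof (rule Suc.IH[OF i(2)])
      show "(u \<circ> F i) y = 0" if "y \<in> B" for y
        using zero_on_V1[OF Suc.prems(2) Suc.prems(3)] that i(1) by (auto simp: V_Suc V_0)
      show "E n (u \<circ> F i) (u \<circ> F i) = 0" for n
        using cell_form_le[OF i(1), of n u] Suc.prems(3)[of "Suc n"] level_form_nonneg[of n "u \<circ> F i"]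
        by simp
    qed
    then show ?case using i by simp
  qed
  show ?thesis
  proof (rule ccontr)
    assume "u x \<noteq> 0"
    then have "\<bar>u x\<bar> > 0" by simp
    then obtain d where d: "d > 0" "\<And>y. y \<in> K \<Longrightarrow> dist y x < d \<Longrightarrow> dist (u y) (u x) < \<bar>u x\<bar>"
      using assms(1) \<open>x \<in> K\<close> unfolding continuous_on_iff by meson
    obtain m y where "y \<in> V m" "dist x y < d" using vertices_dense[OF \<open>x \<in> K\<close> d(1)] by metis
    moreover have "y \<in> K" using \<open>y \<in> V m\<close> V_subset_K by blast
    ultimately show False
      using d(2)[of y] vert[OF \<open>y \<in> V m\<close> assms(2,3)] by (simp add: dist_commute)
  qed
qed

text \<open>The continuous functions whose energy is the least possible for their values on \<open>V m\<close>: the sequence of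
  energies is non-decreasing, so this means that it is constant from \<open>m\<close> on.\<close>

definition harmonic_above :: "nat \<Rightarrow> ('a \<Rightarrow> real) \<Rightarrow> bool" where
  "harmonic_above m u \<longleftrightarrow> continuous_on K u \<and> (\<forall>n\<ge>m. E n u u = E m u u)"

text \<open>Parallelogram law: half the sum of two minimizers has at least the minimal energy, so their
  difference has none.\<close>

lemma harmonic_above_unique:
  assumes u: "harmonic_above m u" and v: "harmonic_above m v"
    and eq: "\<And>p. p \<in> V m \<Longrightarrow> u p = v p" and "x \<in> K"
  shows "u x = v x"
proof -
  have m: "E m v v = E m u u" using eq by (intro level_form_cong) auto
  have 0: "E n (\<lambda>x. u x - v x) (\<lambda>x. u x - v x) = 0" if "n \<ge> m" for n
  proof -
    have "E m (\<lambda>x. (u x + v x) / 2) (\<lambda>x. (u x + v x) / 2) = E m u u"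
      using eq by (intro level_form_cong) auto
    then have "E m u u \<le> E n (\<lambda>x. (u x + v x) / 2) (\<lambda>x. (u x + v x) / 2)"
      using level_form_mono[OF that, of "\<lambda>x. (u x + v x) / 2"] by simp
    moreover have "E n u u = E m u u" using u that unfolding harmonic_above_def by blast
    moreover have "E n v v = E m u u" using v that unfolding harmonic_above_def m[symmetric] by blast
    ultimately show ?thesis
      using level_form_parallelogram[of n u v] level_form_nonneg[of n "\<lambda>x. u x - v x"] by simp
  qed
  have "E n (\<lambda>x. u x - v x) (\<lambda>x. u x - v x) = 0" for n
    using 0[of "max m n"] level_form_mono[of n "max m n" "\<lambda>x. u x - v x"]
      level_form_nonneg[of n "\<lambda>x. u x - v x"] by simp
  moreover have "continuous_on K (\<lambda>x. u x - v x)"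
    using u v unfolding harmonic_above_def by (intro continuous_on_diff) blast+
  moreover have "u p - v p = 0" if "p \<in> B" for p
    using eq[of p] B_subset_V[of m] that by auto
  ultimately have "u x - v x = 0"
    using zero_if_energy_0[of "\<lambda>x. u x - v x"] \<open>x \<in> K\<close> by blast
  then show ?thesis by simp
qed

lemma harmonic_above_const: "harmonic_above m (\<lambda>_. c)"
proof -
  have "E n (\<lambda>_. c) (\<lambda>_. c) \<le> 0" for n
  proof -
    have "E n (\<lambda>_. c) (\<lambda>_. c) \<le> E n (\<lambda>_. 0) (\<lambda>_. 0)" by (rule level_form_contraction) simp
    also have "\<dots> = 0" unfolding level_form_def dform_expand by simp
    finally show ?thesis .
  qed
  then have "E n (\<lambda>_. c) (\<lambda>_. c) = 0" for n using level_form_nonneg by (intro order_antisym)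
  then show ?thesis unfolding harmonic_above_def by simp
qed

text \<open>The energy of every cell is non-decreasing in the level, so none of them can increase if the
  total does not.\<close>

lemma harmonic_above_cell:
  assumes u: "harmonic_above (Suc m) u" and i: "i \<in> S"
  shows "harmonic_above m (u \<circ> F i)"
  unfolding harmonic_above_def
proof (intro conjI allI impI)
  show "continuous_on K (u \<circ> F i)"
    using u i continuous_on_comp_F unfolding harmonic_above_def by blast
  fix n assume n: "n \<ge> m"
  let ?f = "\<lambda>n i. E n (u \<circ> F i) (u \<circ> F i) / r i"
  have le: "?f m j \<le> ?f n j" if "j \<in> S" for j
    using r_pos[OF that] level_form_mono[OF n] by (intro divide_right_mono) auto
  have "E (Suc n) u u = E (Suc m) u u" using u n unfolding harmonic_above_def by blast
  then have "sum (?f m) S = sum (?f n) S" unfolding level_form_Suc by simp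
  then have "?f m i = ?f n i"
    using sum_mono_inv[of "?f m" S "?f n" i] le i finite_S by blast
  then show "E n (u \<circ> F i) (u \<circ> F i) = E m (u \<circ> F i) (u \<circ> F i)" using r_pos[OF i] by simp
qed

end


section \<open>Tent functions\<close>

context harmonic_set
begin

text \<open>Any competitor has at least the energy of its values on \<open>V m\<close>, and the harmonic extension attains it.
  So a minimizer exists, and every minimizer is harmonic above level \<open>m\<close>.\<close>

lemma tent_minimizer:
  assumes p: "p \<in> V m"
  shows "harmonic_above m (tent s F K H r m p) \<and> (\<forall>q\<in>V m. tent s F K H r m p q = indicator {p} q)"
proof -
  let ?d = "indicator {p} :: 'a \<Rightarrow> real" and ?en = "energy s F K H r"
  let ?P = "\<lambda>u. u \<in> energy_dom s F K H r \<and> u p = 1 \<and> (\<forall>q\<in>V m - {p}. u q = 0)"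
  obtain u0 where u0: "continuous_on K u0" "\<And>q. q \<in> V m \<Longrightarrow> u0 q = ?d q"
    "\<And>n. n \<ge> m \<Longrightarrow> E n u0 u0 = E m ?d ?d"
    using harmonic_extension_exists[of m ?d] by metis
  have "E n u0 u0 \<le> E m ?d ?d" for n
    using level_form_mono[of n "max m n" u0] u0(3)[of "max m n"] by simp
  then have en0: "?en u0 \<le> ereal (E m ?d ?d)"
    unfolding energy_eq_SUP by (intro SUP_least) simp
  have bd: "E m u u = E m ?d ?d" if "?P u" for u
    using that by (intro level_form_cong) (auto simp: indicator_def)
  have "?en u0 < \<infinity>" using en0 by (rule le_less_trans) simp
  then have P0: "?P u0"
    using u0(1,2) p unfolding energy_dom_def by auto
  have low: "\<not> ?en u < ?en u0" if "?P u" for u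
    using order_trans[OF en0, of "?en u"] level_form_le_energy[of m u] unfolding bd[OF that]
    by (auto simp: not_less)
  have all: "harmonic_above m u \<and> (\<forall>q\<in>V m. u q = ?d q)" if u: "?P u" "\<forall>y. ?P y \<longrightarrow> \<not> ?en y < ?en u" for u
  proof -
    have "?en u \<le> ereal (E m ?d ?d)" using u(2) P0 en0 by (meson not_less order_trans)
    then have "E n u u \<le> E m ?d ?d" for n using level_form_le_energy[of n u] order_trans by fastforce
    then have "E n u u = E m u u" if "n \<ge> m" for n
      using level_form_mono[OF that, of u] bd[OF u(1)] by (simp add: order_antisym)
    then have "harmonic_above m u"
      using u(1) unfolding harmonic_above_def energy_dom_def by blast
    moreover have "\<forall>q\<in>V m. u q = ?d q" using u(1) by (auto simp: indicator_def)
    ultimately show ?thesis ..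
  qed
  show ?thesis
    unfolding tent_def
    by (rule arg_minI[where P = ?P and f = ?en
          and Q = "\<lambda>u. harmonic_above m u \<and> (\<forall>q\<in>V m. u q = ?d q)", OF P0 low all])
qed

lemma indicator_cell:
  assumes "i \<in> S" "j \<in> S" "p \<in> V m - B" "q \<in> V m"
  shows "indicator {F i p} (F j q) = (if j = i then indicator {p} q else (0::real))"
proof -
  have K: "p \<in> K" "q \<in> K" using assms V_subset_K by blast+
  show ?thesis
  proof (cases "j = i")
    case True
    then show ?thesis using F_eq_iff[OF assms(1) K(2,1)] by (simp add: indicator_def)
  next
    case False
    then have "F j q \<noteq> F i p" using overlap_in_B[OF assms(1,2) _ K] assms(3) by force
    then show ?thesis using False by simp
  qed
qed

text \<open>The tent at an inner vertex of one cell lives in this cell, where it is the tent of the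
  preceding level.\<close>

lemma tent_cell:
  assumes "i \<in> S" "j \<in> S" "p \<in> V m - B" "x \<in> K"
  shows "tent s F K H r (Suc m) (F i p) (F j x) = (if j = i then tent s F K H r m p x else 0)"
proof -
  let ?t = "tent s F K H r (Suc m) (F i p)"
  have "F i p \<in> V (Suc m)" using assms by (auto simp: V_Suc)
  note t = tent_minimizer[OF this]
  have val: "(?t \<circ> F j) q = (if j = i then indicator {p} q else 0)" if "q \<in> V m" for q
  proof -
    have "F j q \<in> V (Suc m)" using that assms(2) by (auto simp: V_Suc)
    then show ?thesis using t indicator_cell[OF assms(1-3) that] by simp
  qed
  have har: "harmonic_above m (?t \<circ> F j)" using t harmonic_above_cell assms(2) by blast
  show ?thesis
  proof (cases "j = i")
    case True
    have "p \<in> V m" using assms by simp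
    note tp = tent_minimizer[OF this]
    have "(?t \<circ> F j) x = tent s F K H r m p x"
      using tp val True by (intro harmonic_above_unique[OF har _ _ \<open>x \<in> K\<close>]) auto
    then show ?thesis using True by simp
  next
    case False
    have "(?t \<circ> F j) x = 0"
      using val False by (intro harmonic_above_unique[OF har harmonic_above_const _ \<open>x \<in> K\<close>]) auto
    then show ?thesis using False by simp
  qed
qed

lemma level_apply_eq:
  assumes "p \<in> V m"
  shows "level_apply s F K H r m u p = - E m (indicator {p}) u"
proof -
  let ?L = "level_laplacian s F K H r m"
  have "E m (indicator {p}) u = - (\<Sum>x\<in>V m. indicator {p} x * op_apply (V m) ?L u x)"
    unfolding dform_level_laplacian[OF finite_B, symmetric] dform_def ..
  also have "(\<Sum>x\<in>V m. indicator {p} x * op_apply (V m) ?L u x) = (\<Sum>x\<in>V m. if x = p then op_apply (V m) ?L u x else 0)"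
    by (intro sum.cong) (auto simp: indicator_def)
  finally show ?thesis
    unfolding level_apply_def using assms finite_V by (simp add: sum.delta)
qed

lemma level_apply_cell:
  assumes i: "i \<in> S" and p: "p \<in> V m - B"
  shows "level_apply s F K H r (Suc m) u (F i p) = level_apply s F K H r m (u \<circ> F i) p / r i"
proof -
  have "E m (indicator {F i p} \<circ> F j) (u \<circ> F j) / r j = (if j = i then E m (indicator {p}) (u \<circ> F i) / r i else 0)"
    if j: "j \<in> S" for j
  proof (cases "j = i")
    case True
    then have "E m (indicator {F i p} \<circ> F j) (u \<circ> F j) = E m (indicator {p}) (u \<circ> F i)"
      using indicator_cell[OF i i p] by (intro level_form_cong) auto
    then show ?thesis using True by simp
  next
    case False
    then have "E m (indicator {F i p} \<circ> F j) (u \<circ> F j) = E m (\<lambda>_. 0) (u \<circ> F j)"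
      using indicator_cell[OF i j p] by (intro level_form_cong) auto
    also have "\<dots> = 0" unfolding level_form_def dform_expand by simp
    finally show ?thesis using False by simp
  qed
  then have "E (Suc m) (indicator {F i p}) u = E m (indicator {p}) (u \<circ> F i) / r i"
    unfolding level_form_Suc using i finite_S by (simp add: sum.delta)
  moreover have "F i p \<in> V (Suc m)" "p \<in> V m" using i p by (auto simp: V_Suc)
  ultimately show ?thesis by (simp add: level_apply_eq)
qed

end

section \<open>The Laplacian on a cell\<close>

locale laplacian_set = harmonic_set s F K H r
  for s :: nat and F :: "nat \<Rightarrow> 'a::complete_space \<Rightarrow> 'a" and K :: "'a set"
    and H :: "'a \<Rightarrow> 'a \<Rightarrow> real" and r :: "nat \<Rightarrow> real" +
  fixes \<mu> :: "nat \<Rightarrow> real" and M :: "'a measure"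
  assumes self_similar_measure: "self_similar_measure s F K \<mu> M"

sublocale laplacian_set \<subseteq> prob: prob_space M
  using self_similar_measure unfolding self_similar_measure_def by blast

context laplacian_set
begin

lemma \<mu>_pos: "i \<in> S \<Longrightarrow> \<mu> i > 0" and \<mu>_less_1: "i \<in> S \<Longrightarrow> \<mu> i < 1"
  and sets_M: "sets M = sets (restrict_space borel K)"
  and measure_cells: "A \<in> sets M \<Longrightarrow> measure M A = (\<Sum>i\<in>S. \<mu> i * measure M (F i -` A \<inter> K))"
  using self_similar_measure unfolding self_similar_measure_def S_def by auto

lemma space_M: "space M = K"
  using sets_eq_imp_space_eq[OF sets_M] by (simp add: space_restrict_space)

lemma measurable_F: "i \<in> S \<Longrightarrow> F i \<in> measurable M M"
proof -
  assume i: "i \<in> S"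
  have "F i \<in> measurable (restrict_space borel K) (restrict_space borel K)"
    using i F_in_K continuous_on_F
    by (intro measurable_restrict_space2 borel_measurable_continuous_on_restrict) (auto simp: space_restrict_space)
  then show ?thesis using measurable_cong_sets[OF sets_M sets_M] by blast
qed

lemma continuous_measurable: "continuous_on K g \<Longrightarrow> g \<in> borel_measurable M"
  using borel_measurable_continuous_on_restrict measurable_cong_sets[OF sets_M refl] by blast

lemma continuous_integrable:
  fixes g :: "'a \<Rightarrow> real"
  assumes "continuous_on K g"
  shows "integrable M g"
proof -
  have "bounded (g ` K)" using compact_continuous_image[OF assms compact_K] compact_imp_bounded by blast
  then obtain b where "\<And>x. x \<in> K \<Longrightarrow> norm (g x) \<le> b" unfolding bounded_iff by blast
  then show ?thesis
    using continuous_measurable[OF assms] by (intro prob.integrable_const_bound[of _ b] AE_I2) (auto simp: space_M)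
qed

lemma emeasure_cells:
  assumes "A \<in> sets M"
  shows "emeasure M A = (\<Sum>i\<in>S. ennreal (\<mu> i) * emeasure M (F i -` A \<inter> space M))"
proof -
  have "emeasure M A = ennreal (\<Sum>i\<in>S. \<mu> i * measure M (F i -` A \<inter> K))"
    using measure_cells[OF assms] prob.emeasure_eq_measure by simp
  also have "\<dots> = (\<Sum>i\<in>S. ennreal (\<mu> i * measure M (F i -` A \<inter> K)))"
    using \<mu>_pos by (intro sum_ennreal[symmetric]) (simp add: less_imp_le)
  also have "\<dots> = (\<Sum>i\<in>S. ennreal (\<mu> i) * emeasure M (F i -` A \<inter> space M))"
    using \<mu>_pos by (intro sum.cong refl) (simp add: prob.emeasure_eq_measure space_M ennreal_mult less_imp_le)
  finally show ?thesis .
qed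

lemma nn_integral_cells:
  assumes "f \<in> borel_measurable M"
  shows "(\<integral>\<^sup>+x. f x \<partial>M) = (\<Sum>i\<in>S. ennreal (\<mu> i) * (\<integral>\<^sup>+x. f (F i x) \<partial>M))"
  using assms
proof (induction rule: borel_measurable_induct)
  case (cong f g)
  have "(\<integral>\<^sup>+x. f (F i x) \<partial>M) = (\<integral>\<^sup>+x. g (F i x) \<partial>M)" if "i \<in> S" for i
    using cong(3) F_in_K[OF that] by (intro nn_integral_cong) (simp add: space_M)
  moreover have "(\<integral>\<^sup>+x. f x \<partial>M) = (\<integral>\<^sup>+x. g x \<partial>M)" using cong(3) by (intro nn_integral_cong)
  ultimately show ?case using cong(4) by simp
next
  case (set A)
  have "(\<integral>\<^sup>+x. indicator A (F i x) \<partial>M) = emeasure M (F i -` A \<inter> space M)" if "i \<in> S" for i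
  proof -
    have "(\<integral>\<^sup>+x. indicator A (F i x) \<partial>M) = (\<integral>\<^sup>+x. indicator (F i -` A \<inter> space M) x \<partial>M)"
      by (intro nn_integral_cong) (auto simp: indicator_def)
    then show ?thesis using measurable_sets[OF measurable_F[OF that] set] by simp
  qed
  then show ?case using emeasure_cells[OF set] set by simp
next
  case (mult u c)
  have "(\<integral>\<^sup>+x. c * u (F i x) \<partial>M) = c * (\<integral>\<^sup>+x. u (F i x) \<partial>M)" if "i \<in> S" for i
    using measurable_compose[OF measurable_F[OF that] mult(2)] by (intro nn_integral_cmult)
  then show ?case
    using mult by (simp add: nn_integral_cmult sum_distrib_left mult_ac)
next
  case (add u v)
  have "(\<integral>\<^sup>+x. v (F i x) + u (F i x) \<partial>M) = (\<integral>\<^sup>+x. v (F i x) \<partial>M) + (\<integral>\<^sup>+x. u (F i x) \<partial>M)"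
    if "i \<in> S" for i
    using measurable_compose[OF measurable_F[OF that] add(1)]
      measurable_compose[OF measurable_F[OF that] add(3)] by (intro nn_integral_add)
  then show ?case
    using add by (simp add: nn_integral_add sum.distrib distrib_left)
next
  case (seq U)
  have m: "(\<lambda>x. U n (F i x)) \<in> borel_measurable M" if "i \<in> S" for n i
    by (rule measurable_compose[OF measurable_F[OF that] seq(1)])
  have inc: "incseq (\<lambda>n x. U n (F i x))" for i
    using seq(3) by (auto simp: incseq_def le_fun_def)
  have "(\<integral>\<^sup>+x. (SUP n. U n x) \<partial>M) = (SUP n. \<integral>\<^sup>+x. U n x \<partial>M)"
    using seq by (intro nn_integral_monotone_convergence_SUP)
  also have "\<dots> = (SUP n. \<Sum>i\<in>S. ennreal (\<mu> i) * (\<integral>\<^sup>+x. U n (F i x) \<partial>M))"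
    using seq by simp
  also have "\<dots> = (\<Sum>i\<in>S. SUP n. ennreal (\<mu> i) * (\<integral>\<^sup>+x. U n (F i x) \<partial>M))"
    using inc by (intro ennreal_SUP_sum)
      (auto simp: incseq_def le_fun_def intro!: mult_left_mono nn_integral_mono)
  also have "\<dots> = (\<Sum>i\<in>S. ennreal (\<mu> i) * (\<integral>\<^sup>+x. (SUP n. U n (F i x)) \<partial>M))"
    using inc m by (intro sum.cong refl)
      (simp add: SUP_mult_left_ennreal nn_integral_monotone_convergence_SUP)
  finally show ?case by (simp add: image_comp SUP_apply)
qed

lemma integral_cells:
  fixes g :: "'a \<Rightarrow> real"
  assumes g: "continuous_on K g"
  shows "(\<integral>x. g x \<partial>M) = (\<Sum>i\<in>S. \<mu> i * (\<integral>x. g (F i x) \<partial>M))"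
proof -
  have pos: "enn2real (\<integral>\<^sup>+x. ennreal (h x) \<partial>M) = (\<Sum>i\<in>S. \<mu> i * enn2real (\<integral>\<^sup>+x. ennreal (h (F i x)) \<partial>M))"
    if h: "continuous_on K h" for h :: "'a \<Rightarrow> real"
  proof -
    have fin: "(\<integral>\<^sup>+x. ennreal (h (F i x)) \<partial>M) < \<top>" if "i \<in> S" for i
      using continuous_integrable[OF continuous_on_comp_F[OF h that]]
      unfolding real_integrable_def comp_apply by (auto simp: less_top)
    have "enn2real (\<integral>\<^sup>+x. ennreal (h x) \<partial>M) = enn2real (\<Sum>i\<in>S. ennreal (\<mu> i) * (\<integral>\<^sup>+x. ennreal (h (F i x)) \<partial>M))"
      using continuous_measurable[OF h] by (subst nn_integral_cells) auto
    also have "\<dots> = (\<Sum>i\<in>S. enn2real (ennreal (\<mu> i) * (\<integral>\<^sup>+x. ennreal (h (F i x)) \<partial>M)))"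
      using fin by (subst enn2real_sum) (auto simp: ennreal_mult_less_top)
    also have "\<dots> = (\<Sum>i\<in>S. \<mu> i * enn2real (\<integral>\<^sup>+x. ennreal (h (F i x)) \<partial>M))"
      using \<mu>_pos by (intro sum.cong refl) (simp add: enn2real_mult less_imp_le)
    finally show ?thesis .
  qed
  have "(\<integral>x. g x \<partial>M) = enn2real (\<integral>\<^sup>+x. ennreal (g x) \<partial>M) - enn2real (\<integral>\<^sup>+x. ennreal (- g x) \<partial>M)"
    by (rule real_lebesgue_integral_def[OF continuous_integrable[OF g]])
  also have "\<dots> = (\<Sum>i\<in>S. \<mu> i * (enn2real (\<integral>\<^sup>+x. ennreal (g (F i x)) \<partial>M) -
      enn2real (\<integral>\<^sup>+x. ennreal (- g (F i x)) \<partial>M)))"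
    unfolding pos[OF g] pos[OF continuous_on_minus[OF g]] by (simp add: sum_subtractf right_diff_distrib)
  also have "\<dots> = (\<Sum>i\<in>S. \<mu> i * (\<integral>x. g (F i x) \<partial>M))"
    using real_lebesgue_integral_def[OF continuous_integrable[OF continuous_on_comp_F[OF g]], unfolded comp_def]
    by (intro sum.cong refl) simp
  finally show ?thesis .
qed

lemma tent_mass_cell:
  assumes i: "i \<in> S" and p: "p \<in> V m - B"
  shows "tent_mass s F K H r M (Suc m) (F i p) = \<mu> i * tent_mass s F K H r M m p"
proof -
  let ?t = "tent s F K H r (Suc m) (F i p)"
  have "F i p \<in> V (Suc m)" using i p by (auto simp: V_Suc)
  then have "continuous_on K ?t" using tent_minimizer unfolding harmonic_above_def by blast
  then have "(\<integral>x. ?t x \<partial>M) = (\<Sum>j\<in>S. \<mu> j * (\<integral>x. ?t (F j x) \<partial>M))" by (rule integral_cells)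
  also have "\<dots> = (\<Sum>j\<in>S. if j = i then \<mu> i * (\<integral>x. tent s F K H r m p x \<partial>M) else 0)"
  proof (intro sum.cong refl)
    fix j assume j: "j \<in> S"
    have "(\<integral>x. ?t (F j x) \<partial>M) = (\<integral>x. (if j = i then tent s F K H r m p x else 0) \<partial>M)"
      using tent_cell[OF i j p] by (intro Bochner_Integration.integral_cong refl) (simp add: space_M)
    then show "\<mu> j * (\<integral>x. ?t (F j x) \<partial>M) = (if j = i then \<mu> i * (\<integral>x. tent s F K H r m p x \<partial>M) else 0)"
      by simp
  qed
  finally show ?thesis unfolding tent_mass_def using i finite_S by (simp add: sum.delta)
qed

text \<open>In the quotient that defines the Laplacian, the graph Laplacian scales by \<open>1 / r i\<close> and the tent
  mass by \<open>\<mu> i\<close>, and the inner vertices of a cell are inner vertices of \<open>K\<close>.\<close>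

lemma has_laplacian_cell:
  assumes u: "has_laplacian s F K H r M u f" and i: "i \<in> S"
  shows "has_laplacian s F K H r M (u \<circ> F i) (\<lambda>x. r i * \<mu> i * f (F i x))"
proof -
  let ?err = "\<lambda>m u f p. \<bar>inverse (tent_mass s F K H r M m p) * level_apply s F K H r m u p - f p\<bar>"
  let ?max = "\<lambda>m u f. Max (insert 0 (?err m u f ` (V m - B)))"
  let ?g = "\<lambda>x. r i * \<mu> i * f (F i x)"
  have c: "r i * \<mu> i > 0" using r_pos \<mu>_pos i by simp
  have err: "?err m (u \<circ> F i) ?g p \<le> r i * \<mu> i * ?max (Suc m) u f" if p: "p \<in> V m - B" for m p
  proof -
    have "F i p \<in> V (Suc m) - B" using p i in_B_of_F_in_B V_subset_K[of m] by (auto simp: V_Suc)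
    then have "?err (Suc m) u f (F i p) \<le> ?max (Suc m) u f"
      using finite_V by (intro Max_ge) auto
    moreover have "?err m (u \<circ> F i) ?g p = r i * \<mu> i * ?err (Suc m) u f (F i p)"
    proof -
      have "inverse (tent_mass s F K H r M m p) * level_apply s F K H r m (u \<circ> F i) p - ?g p =
        r i * \<mu> i * (inverse (tent_mass s F K H r M (Suc m) (F i p)) * level_apply s F K H r (Suc m) u (F i p) - f (F i p))"
        using r_pos[OF i] \<mu>_pos[OF i] unfolding tent_mass_cell[OF i p] level_apply_cell[OF i p]
        by (simp add: field_simps)
      then show ?thesis using c by (simp only: abs_mult[of "r i * \<mu> i"] abs_of_pos[OF c])
    qed
    ultimately show ?thesis using c by (simp add: mult_left_mono)
  qed
  have nonneg: "0 \<le> ?max m u f" for m u f using finite_V by simp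
  have "(\<lambda>m. ?max m u f) \<longlonglongrightarrow> 0" using u unfolding has_laplacian_def by blast
  then have "(\<lambda>m. r i * \<mu> i * ?max (Suc m) u f) \<longlonglongrightarrow> r i * \<mu> i * 0"
    by (intro tendsto_intros LIMSEQ_Suc)
  then have lim: "(\<lambda>m. r i * \<mu> i * ?max (Suc m) u f) \<longlonglongrightarrow> 0" by simp
  have le: "?max m (u \<circ> F i) ?g \<le> r i * \<mu> i * ?max (Suc m) u f" for m
  proof (rule Max.boundedI)
    show "finite (insert 0 (?err m (u \<circ> F i) ?g ` (V m - B)))" using finite_V by simp
    fix a assume "a \<in> insert 0 (?err m (u \<circ> F i) ?g ` (V m - B))"
    then show "a \<le> r i * \<mu> i * ?max (Suc m) u f"
      using err c nonneg[of "Suc m" u f] by auto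
  qed simp
  have "(\<lambda>m. ?max m (u \<circ> F i) ?g) \<longlonglongrightarrow> 0"
    by (rule tendsto_sandwich[OF _ _ tendsto_const lim]) (intro always_eventually allI nonneg le)+
  moreover have "continuous_on K (u \<circ> F i)" "continuous_on K (f \<circ> F i)"
    using u i continuous_on_comp_F unfolding has_laplacian_def by blast+
  ultimately show ?thesis
    unfolding has_laplacian_def by (auto intro!: continuous_intros simp: o_def)
qed

text \<open>The zero function is admitted because a nonzero eigenfunction may vanish on a whole cell.\<close>

definition eigen_equation :: "real \<Rightarrow> ('a \<Rightarrow> real) \<Rightarrow> bool" where
  "eigen_equation lam u \<longleftrightarrow> (\<exists>f. has_laplacian s F K H r M u f \<and> (\<forall>x\<in>K - B. - f x = lam * u x))"

lemma eigenfunction_iff: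
  "eigenfunction s F K H r M lam u \<longleftrightarrow> (\<exists>x\<in>K. u x \<noteq> 0) \<and> eigen_equation lam u"
  unfolding eigenfunction_def eigen_equation_def ..

lemma eigen_equation_cell:
  assumes "eigen_equation lam u" "i \<in> S"
  shows "eigen_equation (r i * \<mu> i * lam) (u \<circ> F i)"
proof -
  obtain f where f: "has_laplacian s F K H r M u f" "\<And>x. x \<in> K - B \<Longrightarrow> - f x = lam * u x"
    using assms unfolding eigen_equation_def by blast
  have "- (r i * \<mu> i * f (F i x)) = r i * \<mu> i * lam * (u \<circ> F i) x" if "x \<in> K - B" for x
  proof -
    have "F i x \<in> K - B" using that assms(2) F_in_K in_B_of_F_in_B by blast
    from f(2)[OF this] show ?thesis by (simp add: algebra_simps flip: mult_minus_right)
  qed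
  then show ?thesis
    using has_laplacian_cell[OF f(1) assms(2)] unfolding eigen_equation_def by blast
qed

end


section \<open>Extreme sets\<close>

abbreviation "num X \<equiv> emeasure (count_space UNIV) X"

context pcf_set
begin

abbreviation "Extr u \<equiv> extreme_sets s F K u"

lemma extreme_setE:
  assumes "A \<in> Extr u"
  obtains c where "A \<noteq> {}" "A \<in> components {x\<in>K. u x = c}" "A \<inter> B = {}" "connected A" "A \<subseteq> K"
    "\<And>x. x \<in> A \<Longrightarrow> u x = c"
proof -
  obtain c where c: "A \<noteq> {}" "A \<in> components {x\<in>K. u x = c}" "A \<inter> B = {}"
    using assms unfolding extreme_sets_def by (elim CollectE conjE exE)
  have "A \<subseteq> {x\<in>K. u x = c}" using c(2) by (rule in_components_subset)
  then show thesis using that[OF c in_components_connected[OF c(2)]] by auto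
qed

lemma extreme_sets_disjoint:
  assumes "A \<in> Extr u" "A' \<in> Extr u" "x \<in> A" "x \<in> A'"
  shows "A = A'"
proof -
  obtain c where c: "A \<in> components {x\<in>K. u x = c}" "u x = c"
    using extreme_setE[OF assms(1)] assms(3) by metis
  obtain c' where c': "A' \<in> components {x\<in>K. u x = c'}" "u x = c'"
    using extreme_setE[OF assms(2)] assms(4) by metis
  have "A' \<in> components {x\<in>K. u x = c}" using c(2) c' by simp
  then show ?thesis using components_nonoverlap[OF c(1)] assms(3,4) by blast
qed

text \<open>The traces on \<open>A\<close> of the cell \<open>i\<close> and of the union of the other cells are closed and, away from \<open>V 1\<close>, disjoint.\<close>

lemma extreme_set_in_cell:
  assumes A: "A \<in> Extr u" and disj: "A \<inter> V 1 = {}"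
  obtains i where "i \<in> S" "A \<subseteq> F i ` K"
proof -
  have conn: "connected A" and "A \<subseteq> K" and "A \<noteq> {}" by (rule extreme_setE[OF A], assumption)+
  then obtain y where "y \<in> A" "y \<in> K" by blast
  then obtain i a where i: "i \<in> S" "a \<in> K" "F i a \<in> A" using K_cases by metis
  let ?R = "\<Union>j\<in>S - {i}. F j ` K"
  have meet: False if j: "j \<in> S - {i}" "x \<in> K" "y \<in> K" "F i x = F j y" "F i x \<in> A" for j x y
  proof -
    have "x \<in> B" using overlap_in_B[of i j x y] i j by auto
    then have "F i x \<in> V 1" using i by (auto simp: V_Suc V_0)
    then show False using j disj by blast
  qed
  have "F i ` K \<inter> A = {} \<or> ?R \<inter> A = {}"
  proof (rule connected_closedD[OF conn])
    show "F i ` K \<inter> ?R \<inter> A = {}" using meet by blast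
    show "A \<subseteq> F i ` K \<union> ?R"
    proof
      fix x assume "x \<in> A"
      then obtain j y where "j \<in> S" "y \<in> K" "x = F j y" using \<open>A \<subseteq> K\<close> K_cases by (metis subsetD)
      then show "x \<in> F i ` K \<union> ?R" by (cases "j = i") auto
    qed
    show "closed (F i ` K)" "closed ?R"
      using closed_cells[of "{i}"] closed_cells[of "S - {i}"] i by auto
  qed
  then have "?R \<inter> A = {}" using i by blast
  have "A \<subseteq> F i ` K"
  proof
    fix x assume "x \<in> A"
    then obtain j y where "j \<in> S" "y \<in> K" "x = F j y" using \<open>A \<subseteq> K\<close> K_cases by (metis subsetD)
    then show "x \<in> F i ` K" using \<open>?R \<inter> A = {}\<close> \<open>x \<in> A\<close> by (cases "j = i") auto
  qed
  then show thesis using that i by blast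
qed

text \<open>Since \<open>F i\<close> is a homeomorphism onto its cell, it preserves components; as it does not increase distances,
  the same \<open>\<delta>\<close> serves for the preimage.\<close>

lemma extreme_set_pullback:
  assumes A: "A \<in> Extr u" and i: "i \<in> S" and sub: "A \<subseteq> F i ` K" and disj: "A \<inter> V 1 = {}"
  shows "F i -` A \<inter> K \<in> Extr (u \<circ> F i)"
proof -
  let ?P = "F i -` A \<inter> K"
  obtain c \<delta> where c: "A \<noteq> {}" "A \<in> components {x\<in>K. u x = c}" and \<delta>: "\<delta> > 0"
    "(\<forall>x\<in>K \<inter> (\<Union>a\<in>A. ball a \<delta>). u x \<le> c) \<or> (\<forall>x\<in>K \<inter> (\<Union>a\<in>A. ball a \<delta>). u x \<ge> c)"
    using A unfolding extreme_sets_def by (elim CollectE conjE exE)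
  have img: "F i ` ?P = A" using sub by blast
  have comp: "?P \<in> components {x\<in>K. (u \<circ> F i) x = c}"
    unfolding in_components_maximal
  proof (intro conjI allI impI)
    show "?P \<noteq> {}" using img c(1) by blast
    show "?P \<subseteq> {x\<in>K. (u \<circ> F i) x = c}" using in_components_subset[OF c(2)] by auto
    have "inv_into K (F i) ` A = ?P"
    proof
      show "inv_into K (F i) ` A \<subseteq> ?P" using sub by (auto simp: f_inv_into_f inv_into_into)
      show "?P \<subseteq> inv_into K (F i) ` A"
      proof
        fix x assume "x \<in> ?P"
        then show "x \<in> inv_into K (F i) ` A" using inj_F[OF i] by (intro image_eqI[of _ _ "F i x"]) auto
      qed
    qed
    then show "connected ?P"
      using connected_continuous_image[OF continuous_on_subset[OF continuous_on_cell_inverse[OF i] sub]]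
        in_components_connected[OF c(2)] by simp
    fix D assume D: "D \<noteq> {} \<and> ?P \<subseteq> D \<and> D \<subseteq> {x\<in>K. (u \<circ> F i) x = c} \<and> connected D"
    then have "connected (F i ` D)" using connected_continuous_image continuous_on_F[OF i] by blast
    moreover have "A \<subseteq> F i ` D" using D img by blast
    moreover have "F i ` D \<subseteq> {x\<in>K. u x = c}" using D F_in_K[OF i] by auto
    ultimately have "F i ` D = A"
      using c(2) unfolding in_components_maximal by (metis subset_empty)
    then show "D = ?P" using D by blast
  qed
  have "?P \<inter> B = {}" using disj i by (force simp: V_Suc V_0)
  have ball: "F i x \<in> K \<inter> (\<Union>a\<in>A. ball a \<delta>)" if x: "x \<in> K \<inter> (\<Union>a\<in>?P. ball a \<delta>)" for x
  proof -
    obtain a where "a \<in> ?P" "dist a x < \<delta>" using x by auto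
    then have "F i a \<in> A" "dist (F i a) (F i x) < \<delta>" using dist_F_le[OF i, of a x] by auto
    then show ?thesis using x F_in_K[OF i] by auto
  qed
  then have "(\<forall>x\<in>K \<inter> (\<Union>a\<in>?P. ball a \<delta>). (u \<circ> F i) x \<le> c) \<or>
      (\<forall>x\<in>K \<inter> (\<Union>a\<in>?P. ball a \<delta>). (u \<circ> F i) x \<ge> c)"
    using \<delta>(2) unfolding comp_apply by meson
  moreover have "?P \<noteq> {}" using img c(1) by blast
  ultimately show ?thesis
    using comp \<open>?P \<inter> B = {}\<close> \<open>\<delta> > 0\<close> unfolding extreme_sets_def by blast
qed

lemma count_le_if_inj:
  assumes "inj_on f X" "f ` X \<subseteq> Y"
  shows "emeasure (count_space UNIV) X \<le> emeasure (count_space UNIV) Y"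
proof (cases "finite Y")
  case True
  then have "finite X" using assms inj_on_finite by blast
  then show ?thesis using True card_inj_on_le[OF assms True] by simp
qed simp

text \<open>An extreme set that avoids \<open>V 1\<close> lies in one cell, where it is an extreme set of the restriction;
  the others are told apart by their points in \<open>V 1\<close>.\<close>

lemma num_extr_le_cells:
  "num_extr s F K u \<le> (\<Sum>i\<in>S. num_extr s F K (u \<circ> F i)) + ennreal (card (V 1))"
proof -
  let ?X = "\<lambda>i. {A\<in>Extr u. A \<subseteq> F i ` K \<and> A \<inter> V 1 = {}}" and ?Y = "{A\<in>Extr u. A \<inter> V 1 \<noteq> {}}"
  have X: "num (?X i) \<le> num_extr s F K (u \<circ> F i)" if i: "i \<in> S" for i
    unfolding num_extr_def
  proof (rule count_le_if_inj)
    show "inj_on (\<lambda>A. F i -` A \<inter> K) (?X i)"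
    proof (rule inj_on_inverseI)
      show "F i ` (F i -` A \<inter> K) = A" if "A \<in> ?X i" for A using that by blast
    qed
    show "(\<lambda>A. F i -` A \<inter> K) ` ?X i \<subseteq> Extr (u \<circ> F i)"
      using extreme_set_pullback[OF _ i] by blast
  qed
  have "num ?Y \<le> num (V 1)"
  proof (rule count_le_if_inj)
    have pick: "(SOME p. p \<in> A \<inter> V 1) \<in> A \<inter> V 1" if "A \<in> ?Y" for A
      using that some_in_eq[of "A \<inter> V 1"] by blast
    show "inj_on (\<lambda>A. SOME p. p \<in> A \<inter> V 1) ?Y"
    proof (rule inj_onI)
      fix A A' assume A: "A \<in> ?Y" "A' \<in> ?Y" "(SOME p. p \<in> A \<inter> V 1) = (SOME p. p \<in> A' \<inter> V 1)"
      show "A = A'"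
        using extreme_sets_disjoint[of A u A'] pick[OF A(1)] pick[OF A(2)] A by auto
    qed
    show "(\<lambda>A. SOME p. p \<in> A \<inter> V 1) ` ?Y \<subseteq> V 1" using pick by blast
  qed
  then have Y: "num ?Y \<le> ennreal (card (V 1))"
    using finite_V by (simp add: ennreal_of_nat_eq_real_of_nat)
  have "Extr u \<subseteq> (\<Union>i\<in>S. ?X i) \<union> ?Y"
  proof
    fix A assume A: "A \<in> Extr u"
    show "A \<in> (\<Union>i\<in>S. ?X i) \<union> ?Y"
    proof (cases "A \<inter> V 1 = {}")
      case True
      then obtain i where "i \<in> S" "A \<subseteq> F i ` K" using extreme_set_in_cell[OF A] by metis
      then show ?thesis using A True by blast
    qed (use A in blast)
  qed
  then have "num_extr s F K u \<le> num ((\<Union>i\<in>S. ?X i) \<union> ?Y)"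
    unfolding num_extr_def by (intro emeasure_mono) auto
  also have "\<dots> \<le> num (\<Union>i\<in>S. ?X i) + num ?Y" by (intro emeasure_subadditive) auto
  also have "\<dots> \<le> (\<Sum>i\<in>S. num (?X i)) + num ?Y"
    using finite_S by (intro add_right_mono emeasure_subadditive_finite) auto
  also have "\<dots> \<le> (\<Sum>i\<in>S. num_extr s F K (u \<circ> F i)) + ennreal (card (V 1))"
    by (intro add_mono sum_mono X Y)
  finally show ?thesis .
qed

lemma num_extr_zero:
  assumes "\<And>x. x \<in> K \<Longrightarrow> u x = 0"
  shows "num_extr s F K u \<le> 1"
proof -
  have "Extr u \<subseteq> {K}"
  proof
    fix A assume "A \<in> Extr u"
    then obtain c where A: "A \<noteq> {}" "A \<in> components {x\<in>K. u x = c}" "A \<subseteq> K" "\<And>x. x \<in> A \<Longrightarrow> u x = c"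
      using extreme_setE by metis
    then obtain x where "x \<in> K" "u x = c" by blast
    then have "{x\<in>K. u x = c} = K" using assms by auto
    then have "A \<in> components K" using A by simp
    moreover have "components K = {K}" using connected_K K_nonempty components_eq_sing_iff by blast
    ultimately show "A \<in> {K}" by simp
  qed
  then have "num_extr s F K u \<le> num {K}" unfolding num_extr_def by (intro emeasure_mono) auto
  then show ?thesis by simp
qed

end

section \<open>The spectral dimension and the growth of the counting functions\<close>

text \<open>The sum decreases strictly from \<open>card S\<close> at \<open>d = 0\<close> to \<open>0\<close> at infinity.\<close>

lemma moran_equation:
  fixes g :: "'i \<Rightarrow> real"
  assumes S: "finite S" "card S \<ge> 1" and g: "\<And>i. i \<in> S \<Longrightarrow> 0 < g i" "\<And>i. i \<in> S \<Longrightarrow> g i < 1"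
  shows "\<exists>!d. (\<Sum>i\<in>S. g i powr d) = 1" "(\<Sum>i\<in>S. g i powr d) = 1 \<Longrightarrow> d \<ge> 0"
proof -
  let ?f = "\<lambda>d. \<Sum>i\<in>S. g i powr d"
  have "S \<noteq> {}" using S by auto
  have dec: "?f b < ?f a" if "a < b" for a b
    using S(1) \<open>S \<noteq> {}\<close> g that by (intro sum_strict_mono powr_less_mono') auto
  have "?f 0 = card S" using g by (simp add: less_imp_neq[symmetric])
  then have f0: "?f 0 \<ge> 1" using S(2) by simp
  have "(\<lambda>n. \<Sum>i\<in>S. g i ^ n) \<longlonglongrightarrow> (\<Sum>i\<in>S. 0)"
    using g by (intro tendsto_sum LIMSEQ_power_zero) (simp add: less_imp_le)
  then have "eventually (\<lambda>n. (\<Sum>i\<in>S. g i ^ n) < 1) sequentially"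
    by (rule order_tendstoD(2)) simp
  then obtain n where "(\<Sum>i\<in>S. g i ^ n) < 1" by (auto dest: eventually_happens)
  then have fn: "?f (real n) \<le> 1" using g by (simp add: powr_realpow)
  have "continuous_on {0..real n} ?f" using g by (intro continuous_intros) (simp add: less_imp_neq[symmetric])
  then obtain d where d: "?f d = 1" using IVT2'[of ?f "real n" 1 0] fn f0 by auto
  show "\<exists>!d. ?f d = 1"
  proof (rule ex1I)
    show "?f d = 1" by (rule d)
    show "e = d" if "?f e = 1" for e using dec[of e d] dec[of d e] d that by (cases e d rule: linorder_cases) auto
  qed
  show "d \<ge> 0" if "?f d = 1" for d using dec[of d 0] f0 that by (cases "d < 0") auto
qed

context laplacian_set
begin

text \<open>The factor by which an eigenvalue shrinks on the cell \<open>i\<close>, the square of \<open>\<gamma>\<^sub>i\<close>.\<close>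

definition ratio :: "nat \<Rightarrow> real" where "ratio i = r i * \<mu> i"

lemma ratio: "i \<in> S \<Longrightarrow> 0 < ratio i" "i \<in> S \<Longrightarrow> ratio i < 1"
proof -
  assume i: "i \<in> S"
  show "0 < ratio i" using r_pos[OF i] \<mu>_pos[OF i] unfolding ratio_def by simp
  show "ratio i < 1"
    using r_pos[OF i] \<mu>_pos[OF i] r_less_1[OF i] \<mu>_less_1[OF i] unfolding ratio_def
    by (metis less_imp_le mult_strict_mono mult_1 zero_less_one)
qed

definition half_dim :: real where "half_dim = spectral_dim s r \<mu> / 2"

lemma half_dim: "half_dim \<ge> 0" "(\<Sum>i\<in>S. ratio i powr half_dim) = 1"
proof -
  let ?d = "spectral_dim s r \<mu>"
  have S: "finite S" "card S \<ge> 1" using two_symbols unfolding S_def by auto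
  have g: "0 < sqrt (ratio i)" "sqrt (ratio i) < 1" if "i \<in> S" for i using ratio[OF that] by auto
  have "\<exists>!d. (\<Sum>i\<in>S. sqrt (ratio i) powr d) = 1" by (rule moran_equation(1)[OF S g])
  then have d: "(\<Sum>i\<in>S. sqrt (ratio i) powr ?d) = 1"
    unfolding spectral_dim_def S_def[symmetric] ratio_def by (rule theI')
  show "half_dim \<ge> 0" using moran_equation(2)[OF S g d] unfolding half_dim_def by simp
  have "sqrt (ratio i) powr ?d = ratio i powr half_dim" if "i \<in> S" for i
    using ratio(1)[OF that] unfolding half_dim_def
    by (simp add: powr_half_sqrt[symmetric] powr_powr)
  then show "(\<Sum>i\<in>S. ratio i powr half_dim) = 1" using d by simp
qed

text \<open>The bound \<open>A * lam powr half_dim\<close> alone is not inductive because every subdivision may add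
  \<open>card (V 1)\<close> extreme sets; as there are at least two cells, subtracting this number once makes it so.
  The induction is on the number of subdivisions after which all eigenvalues are below \<open>lam0\<close>.\<close>

lemma num_extr_growth:
  assumes "lam0 > 0"
    and base: "\<And>lam u. 0 \<le> lam \<Longrightarrow> lam < lam0 \<Longrightarrow> eigen_equation lam u \<Longrightarrow> num_extr s F K u \<le> 1"
  shows "\<exists>A>0. \<forall>lam u x. 0 \<le> lam \<longrightarrow> lam \<le> x \<longrightarrow> lam0 \<le> x \<longrightarrow> eigen_equation lam u \<longrightarrow>
    num_extr s F K u \<le> ennreal (A * x powr half_dim)"
proof -
  have "S \<noteq> {}" using one_in_S by blast
  define q Q b where "q = Min (ratio ` S)" and "Q = Max (ratio ` S)" and "b = real (card (V 1))"
  have q: "q > 0" "\<And>i. i \<in> S \<Longrightarrow> q \<le> ratio i" and Q: "Q < 1" "\<And>i. i \<in> S \<Longrightarrow> ratio i \<le> Q"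
    using finite_S \<open>S \<noteq> {}\<close> ratio unfolding q_def Q_def by auto
  have "0 < Q" using Q(2)[OF one_in_S] ratio(1)[OF one_in_S] by simp
  have "q < 1" using q(2)[OF one_in_S] ratio(2)[OF one_in_S] by simp
  \<comment> \<open>No eigenvalue below \<open>q * lam0\<close> arises from one that is at least \<open>lam0\<close>, and on \<open>[q * lam0, lam0)\<close> the
    bound has to be at least \<open>1\<close>.\<close>
  define A where "A = (1 + b) / (q * lam0) powr half_dim"
  have "b \<ge> 0" unfolding b_def by simp
  have "A > 0" using q \<open>lam0 > 0\<close> \<open>b \<ge> 0\<close> unfolding A_def by simp
  have start: "1 + b \<le> A * lam powr half_dim" if "q * lam0 \<le> lam" for lam
  proof -
    have "(q * lam0) powr half_dim \<le> lam powr half_dim"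
      using that q(1) \<open>lam0 > 0\<close> half_dim(1) by (intro powr_mono2) auto
    then have "A * (q * lam0) powr half_dim \<le> A * lam powr half_dim"
      using \<open>A > 0\<close> by (intro mult_left_mono) auto
    then show ?thesis using q(1) \<open>lam0 > 0\<close> unfolding A_def by simp
  qed
  have small: "num_extr s F K u \<le> ennreal (A * lam powr half_dim - b)"
    if "q * lam0 \<le> lam" "lam < lam0" "eigen_equation lam u" for lam u
  proof -
    have "0 < q * lam0" using q(1) \<open>lam0 > 0\<close> by simp
    then have "num_extr s F K u \<le> ennreal 1" using base[of lam u] that by simp
    also have "\<dots> \<le> ennreal (A * lam powr half_dim - b)" using start[OF that(1)] by (intro ennreal_leI) simp
    finally show ?thesis .
  qed
  have step: "num_extr s F K u \<le> ennreal (A * lam powr half_dim - b)"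
    if "q * lam0 \<le> lam" "Q ^ n * lam < lam0" "eigen_equation lam u" for n lam u
    using that
  proof (induction n arbitrary: lam u)
    case 0
    then show ?case using small by simp
  next
    case (Suc n)
    show ?case
    proof (cases "lam < lam0")
      case True
      then show ?thesis using small Suc.prems by blast
    next
      case False
      have lam: "lam > 0" using False \<open>lam0 > 0\<close> by simp
      have low: "q * lam0 \<le> ratio i * lam" if "i \<in> S" for i
        using q \<open>lam0 > 0\<close> ratio(1)[OF that] False that by (intro mult_mono) auto
      have cell: "num_extr s F K (u \<circ> F i) \<le> ennreal (A * (ratio i * lam) powr half_dim - b)" if i: "i \<in> S" for i
      proof (rule Suc.IH[OF low[OF i]])
        have "Q ^ n * (ratio i * lam) \<le> Q ^ n * (Q * lam)"
          using Q(2)[OF i] \<open>0 < Q\<close> lam by (intro mult_left_mono mult_right_mono) auto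
        then show "Q ^ n * (ratio i * lam) < lam0" using Suc.prems(2) by (simp add: mult_ac)
        show "eigen_equation (ratio i * lam) (u \<circ> F i)"
          using eigen_equation_cell[OF Suc.prems(3) i] unfolding ratio_def .
      qed
      have nonneg: "0 \<le> A * (ratio i * lam) powr half_dim - b" if "i \<in> S" for i
        using start[OF low[OF that]] by simp
      have "num_extr s F K u \<le> (\<Sum>i\<in>S. num_extr s F K (u \<circ> F i)) + ennreal b"
        unfolding b_def by (rule num_extr_le_cells)
      also have "\<dots> \<le> (\<Sum>i\<in>S. ennreal (A * (ratio i * lam) powr half_dim - b)) + ennreal b"
        by (intro add_right_mono sum_mono cell)
      also have "\<dots> = ennreal ((\<Sum>i\<in>S. A * (ratio i * lam) powr half_dim - b) + b)"
        using nonneg \<open>b \<ge> 0\<close> by (subst sum_ennreal) (auto intro!: ennreal_plus[symmetric] sum_nonneg)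
      also have "\<dots> \<le> ennreal (A * lam powr half_dim - b)"
      proof (rule ennreal_leI)
        have "(\<Sum>i\<in>S. A * (ratio i * lam) powr half_dim) = A * lam powr half_dim * (\<Sum>i\<in>S. ratio i powr half_dim)"
          unfolding sum_distrib_left
          using ratio lam by (intro sum.cong refl) (simp add: powr_mult less_imp_le)
        moreover have "2 * b \<le> card S * b" using two_symbols \<open>b \<ge> 0\<close> unfolding S_def by (intro mult_right_mono) auto
        ultimately show "(\<Sum>i\<in>S. A * (ratio i * lam) powr half_dim - b) + b \<le> A * lam powr half_dim - b"
          using half_dim(2) by (simp add: sum_subtractf)
      qed
      finally show ?thesis .
    qed
  qed
  show ?thesis
  proof (intro exI[of _ A] conjI allI impI \<open>A > 0\<close>)
    fix lam u x assume lx: "0 \<le> lam" "lam \<le> x" "lam0 \<le> x" "eigen_equation lam u"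
    have "q * lam0 \<le> lam0" using \<open>q < 1\<close> \<open>lam0 > 0\<close> by simp
    show "num_extr s F K u \<le> ennreal (A * x powr half_dim)"
    proof (cases "lam < lam0")
      case True
      then have "num_extr s F K u \<le> ennreal 1" using base lx by simp
      also have "\<dots> \<le> ennreal (A * x powr half_dim)"
        using start[of x] lx \<open>q * lam0 \<le> lam0\<close> \<open>b \<ge> 0\<close> by (intro ennreal_leI) simp
      finally show ?thesis .
    next
      case False
      have "(\<lambda>n. Q ^ n * lam) \<longlonglongrightarrow> 0 * lam"
        using Q \<open>0 < Q\<close> by (intro tendsto_intros LIMSEQ_power_zero) auto
      then have "eventually (\<lambda>n. Q ^ n * lam < lam0) sequentially"
        by (rule order_tendstoD(2)) (simp add: \<open>lam0 > 0\<close>)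
      then obtain n where n: "Q ^ n * lam < lam0" by (auto dest: eventually_happens)
      have "q * lam0 \<le> lam" using False \<open>q * lam0 \<le> lam0\<close> by simp
      then have "num_extr s F K u \<le> ennreal (A * lam powr half_dim - b)" using step n lx by blast
      also have "\<dots> \<le> ennreal (A * x powr half_dim)"
      proof (rule ennreal_leI)
        have "A * lam powr half_dim \<le> A * x powr half_dim"
          using \<open>A > 0\<close> lx half_dim(1) by (intro mult_left_mono powr_mono2) auto
        then show "A * lam powr half_dim - b \<le> A * x powr half_dim" using \<open>b \<ge> 0\<close> by simp
      qed
      finally show ?thesis .
    qed
  qed
qed

end

lemma Limsup_ratio_finite:
  fixes f :: "real \<Rightarrow> ennreal"
  assumes "A > 0" "\<And>x. x \<ge> x0 \<Longrightarrow> f x \<le> ennreal (A * x powr a)"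
  shows "Limsup at_top (\<lambda>x. f x / ennreal (x powr a)) < \<infinity>"
proof -
  have "f x / ennreal (x powr a) \<le> ennreal A" if "x \<ge> x0" "x > 0" for x
  proof -
    have "f x / ennreal (x powr a) \<le> ennreal (A * x powr a) / ennreal (x powr a)"
      using assms(2)[OF that(1)] by (rule divide_right_mono_ennreal)
    also have "\<dots> = ennreal A" using that assms(1) by (simp add: divide_ennreal)
    finally show ?thesis .
  qed
  then have "eventually (\<lambda>x. f x / ennreal (x powr a) \<le> ennreal A) at_top"
    using eventually_conj[OF eventually_ge_at_top[of x0] eventually_gt_at_top[of 0]]
    by (auto elim: eventually_mono)
  then have "Limsup at_top (\<lambda>x. f x / ennreal (x powr a)) \<le> ennreal A" by (rule Limsup_bounded)
  then show ?thesis by (rule le_less_trans) simp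
qed

theorem proposition1p3:
  fixes s :: nat
    and F :: "nat \<Rightarrow> 'a::complete_space \<Rightarrow> 'a"
    and K :: "'a set"
    and H\<^sub>0 :: "'a \<Rightarrow> 'a \<Rightarrow> real"
    and r \<mu> :: "nat \<Rightarrow> real"
    and M :: "'a measure"
    and lam0 :: real
  assumes "self_similar_set s F K"
    and "connected K"
    and "pcf s F K"
    and "regular_harmonic_structure s F K H\<^sub>0 r"
    and "self_similar_measure s F K \<mu> M"
    and "lam0 > 0"
    and "\<And>lam u. 0 \<le> lam \<Longrightarrow> lam < lam0 \<Longrightarrow> eigenfunction s F K H\<^sub>0 r M lam u \<Longrightarrow> num_extr s F K u \<le> 1"
  shows "Limsup at_top
           (\<lambda>x. dirichlet_extr_count s F K H\<^sub>0 r M x / ennreal (x powr (spectral_dim s r \<mu> / 2))) < \<infinity> \<and>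
         Limsup at_top
           (\<lambda>x. neumann_extr_count s F K H\<^sub>0 r M x / ennreal (x powr (spectral_dim s r \<mu> / 2))) < \<infinity>"
proof -
  interpret laplacian_set s F K H\<^sub>0 r \<mu> M
    using assms(1-5) by unfold_locales
  have base: "num_extr s F K u \<le> 1" if "0 \<le> lam" "lam < lam0" "eigen_equation lam u" for lam u
    using assms(7)[of lam u] num_extr_zero[of u] that eigenfunction_iff by blast
  have "\<exists>A>0. \<forall>lam u x. 0 \<le> lam \<longrightarrow> lam \<le> x \<longrightarrow> lam0 \<le> x \<longrightarrow> eigen_equation lam u \<longrightarrow>
      num_extr s F K u \<le> ennreal (A * x powr half_dim)"
    by (rule num_extr_growth[OF assms(6) base])
  then obtain A where "A > 0" and A: "\<forall>lam u x. 0 \<le> lam \<longrightarrow> lam \<le> x \<longrightarrow> lam0 \<le> x \<longrightarrow>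
      eigen_equation lam u \<longrightarrow> num_extr s F K u \<le> ennreal (A * x powr half_dim)"
    by (elim exE conjE)
  have "dirichlet_extr_count s F K H\<^sub>0 r M x \<le> ennreal (A * x powr half_dim)"
    and "neumann_extr_count s F K H\<^sub>0 r M x \<le> ennreal (A * x powr half_dim)" if "x \<ge> lam0" for x
    unfolding dirichlet_extr_count_def neumann_extr_count_def
      dirichlet_eigenfunction_def neumann_eigenfunction_def eigenfunction_iff
    using A that by (auto intro!: SUP_least)
  then show ?thesis
    unfolding half_dim_def[symmetric] using Limsup_ratio_finite[OF \<open>A > 0\<close>] by blast
qed

end
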